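(* Let $p$ be a prime, let $a$ be an integer with $\gcd(a,p)=1$, and let $g$ be an integer of multiplicative order $t$ modulo $p$. Let $U,V$ be real numbers with $U,V\le t$ and $U^6V\ge p^{15/4}$. Then $$N_{a,g,p}(U,V) = \frac{6}{\pi^2}\cdot\frac{UV}{p} + O\left(\left(\frac{U^{6/7}V^{1/7}}{p^{1/28}} + U^{3/13}V^{7/13}\right)p^{o(1)}\right).$$
   Context: For a prime $p$, integers $a,g$ and real $U,V$, let $\mathcal{E}_{a,g,p}(U,V)$ be the set of integer pairs $(x,y)\in[1,U]\times[1,V]$ with $y\equiv a g^x \pmod p$. $N_{a,g,p}(U,V)$ denotes the number of pairs $(x,y)\in\mathcal{E}_{a,g,p}(U,V)$ with $\gcd(x,y)=1$ (the "visible points"). The notation $p^{o(1)}$ denotes a factor which, for every fixed $\varepsilon>0$, is at most $p^{\varepsilon}$ for all sufficiently large $p$; the implied constant in $O(\cdot)$ is absolute (may depend on $\varepsilon$). *)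

theory Defs
  imports "HOL-Analysis.Analysis" "HOL-Number_Theory.Number_Theory"
begin

text \<open>The exponent \<open>nat x\<close> loses nothing, since \<open>x \<ge> 1\<close> on the set below.\<close>

definition exp_curve_points :: "int \<Rightarrow> int \<Rightarrow> nat \<Rightarrow> real \<Rightarrow> real \<Rightarrow> (int \<times> int) set" where
  "exp_curve_points a g p U V =
     {(x, y). real_of_int x \<in> {1..U} \<and> real_of_int y \<in> {1..V} \<and>
              [y = a * g ^ nat x] (mod int p)}"

definition num_visible_points :: "int \<Rightarrow> int \<Rightarrow> nat \<Rightarrow> real \<Rightarrow> real \<Rightarrow> nat" where
  "num_visible_points a g p U V =
     card {(x, y) \<in> exp_curve_points a g p U V. gcd x y = 1}"

end

theory Submission
  imports Defs "HOL-Computational_Algebra.Squarefree"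
begin

text \<open>
  Write \<open>M\<^sub>d\<close> for the number of points both of whose coordinates are divisible by \<open>d\<close>, so that
  \<open>N = \<Sum>\<^bsub>d\<^esub> \<mu>(d) M\<^sub>d\<close>, and put \<open>E = U\<^bsup>6/7\<^esup> V\<^bsup>1/7\<^esup> p\<^bsup>-1/28\<^esup>\<close>; all errors are bounded by \<open>E\<close> alone,
  up to powers of \<open>log p\<close>. For \<open>d \<le> E / \<surd>p\<close> completion gives
  \<open>M\<^sub>d = U V / (d\<^sup>2 p) + O(\<surd>p log\<^sup>2 p)\<close>. If \<open>U < p\<^bsup>3/4\<^esup>\<close>, then already \<open>U V / p \<le> E\<close> and the bound
  for \<open>M\<^sub>1\<close> suffices. Otherwise the \<open>d\<close> in a dyadic range \<open>[\<Delta>, 2\<Delta>)\<close> above \<open>E / \<surd>p\<close> contribute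
  at most a quantity \<open>W\<close> that satisfies two bounds, both obtained by Cauchy's inequality over the
  values \<open>v\<close> in \<open>d v \<equiv> a g\<^bsup>d u\<^esup>\<close>.

  First, shifting \<open>u\<close> by all \<open>j \<le> U / \<Delta>\<close> and then discarding the factors \<open>d\<close> from the resulting
  congruence (which only increases its number of solutions) leaves the linear congruence
  \<open>d\<^sub>1 (i\<^sub>1 - j\<^sub>1) \<equiv> d\<^sub>2 (i\<^sub>2 - j\<^sub>2)\<close> modulo the order of \<open>g\<close>, whence
  \<open>W\<^sup>2 \<lesssim> (V / \<Delta>) (\<Delta>\<^sup>2 + U log p)\<close>. Second, for fixed \<open>u\<close> and \<open>h = g\<^bsup>u\<^esup>\<close> the congruence
  \<open>d\<^sub>2 h^d\<^sub>1 \<equiv> d\<^sub>1 h^d\<^sub>2\<close> determines \<open>d\<^sub>2\<close> from \<open>d\<^sub>1 - d\<^sub>2\<close>, whence \<open>W \<lesssim> (U / \<Delta>) \<surd>V\<close>.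
  Taking the first bound for \<open>\<Delta> < U\<^bsup>2/3\<^esup>\<close> and the second one for larger \<open>\<Delta>\<close> gives \<open>W \<lesssim> E log p\<close>.
\<close>

section \<open>Completion of exponential sums\<close>

text \<open>The additive character e(k/m) of the integers modulo m. The frequency is an integer, so
  differences and conjugates need no truncated subtraction.\<close>

definition root_char :: "nat \<Rightarrow> int \<Rightarrow> complex" where
  "root_char m k = cis (2 * pi * (real_of_int k / real m))"

lemma root_char_add: "root_char m (j + k) = root_char m j * root_char m k"
  by (simp add: root_char_def cis_mult add_divide_distrib distrib_left)

lemma norm_root_char [simp]: "norm (root_char m k) = 1"
  by (simp add: root_char_def)

lemma root_char_0 [simp]: "root_char m 0 = 1"
  by (simp add: root_char_def)

lemma cnj_root_char: "cnj (root_char m k) = root_char m (- k)"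
  by (simp add: root_char_def cis_cnj)

lemma root_char_nat_mult: "root_char m (int n * k) = root_char m k ^ n"
proof -
  have "2 * pi * (real_of_int (int n * k) / real m) = real n * (2 * pi * (real_of_int k / real m))"
    by simp
  then show ?thesis
    by (simp only: root_char_def Complex.DeMoivre)
qed

lemma root_char_eq_1_iff:
  assumes "m > 0"
  shows "root_char m k = 1 \<longleftrightarrow> int m dvd k"
proof
  assume "int m dvd k"
  then obtain j where "k = int m * j" by blast
  then have "2 * pi * (real_of_int k / real m) = 2 * pi * real_of_int j"
    using assms by simp
  then show "root_char m k = 1"
    unfolding root_char_def using cis_multiple_2pi[of "real_of_int j"] by simp
next
  assume "root_char m k = 1"
  then have "cos (2 * pi * (real_of_int k / real m)) = 1"
    by (metis root_char_def cis.sel(1) one_complex.sel(1))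
  then obtain j :: int where "2 * pi * (real_of_int k / real m) = real_of_int j * 2 * pi"
    using cos_one_2pi_int by blast
  then have "real_of_int k = real m * real_of_int j"
    using assms by (simp add: field_simps)
  then have "k = int m * j"
    by (metis of_int_eq_iff of_int_mult of_int_of_nat_eq)
  then show "int m dvd k" by simp
qed

lemma root_char_cong:
  assumes "m > 0" "[j = k] (mod int m)"
  shows "root_char m j = root_char m k"
proof -
  have "root_char m (j - k) = 1"
    using assms by (simp add: root_char_eq_1_iff cong_iff_dvd_diff)
  then show ?thesis
    using root_char_add[of m "j - k" k] by simp
qed

text \<open>Orthogonality of the additive characters. If m does not divide k, the sum is geometric
  with a ratio other than 1 whose m-th power is 1.\<close>

lemma sum_root_char:
  assumes "m > 0"
  shows "(\<Sum>b<m. root_char m (int b * k)) = (if int m dvd k then of_nat m else 0)"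
proof (cases "int m dvd k")
  case True
  then have "root_char m k = 1"
    using assms by (simp add: root_char_eq_1_iff)
  then show ?thesis
    using True by (simp add: root_char_nat_mult)
next
  case False
  then have "root_char m k \<noteq> 1"
    using assms by (simp add: root_char_eq_1_iff)
  moreover have "root_char m k ^ m = 1"
    using assms by (simp add: root_char_nat_mult[symmetric] root_char_eq_1_iff)
  ultimately show ?thesis
    using False by (simp add: root_char_nat_mult geometric_sum)
qed

text \<open>A weak form of Jordan's inequality. Write sin x = 2 sin(x/2) cos(x/2) and sin(x/2) =
  (x/2) cos z; both cosines are taken on [0, \<pi>/4], so their product is at least 1/2.\<close>

lemma sin_ge_half:
  assumes "0 \<le> x" "x \<le> pi / 2"
  shows "x / 2 \<le> sin x"
proof (cases "x = 0")
  case False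
  then have "0 < x / 2" using assms by simp
  then obtain z where z: "0 < z" "z < x / 2" "sin (x / 2) - sin 0 = (x / 2 - 0) * cos z"
    using MVT2[of 0 "x / 2" sin cos] by (metis DERIV_sin)
  have c: "sqrt 2 / 2 \<le> cos y" if "0 \<le> y" "y \<le> pi / 4" for y
    using cos_monotone_0_pi_le[of y "pi / 4"] that by (simp add: cos_45)
  have "sqrt 2 / 2 \<le> cos z" "sqrt 2 / 2 \<le> cos (x / 2)"
    using z assms by (intro c; simp)+
  then have "sqrt 2 / 2 * (sqrt 2 / 2) \<le> cos z * cos (x / 2)"
    by (intro mult_mono) (auto intro: order_trans[of _ "sqrt 2 / 2"])
  then have "1 / 2 \<le> cos z * cos (x / 2)" by simp
  then have "x * (1 / 2) \<le> x * (cos z * cos (x / 2))"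
    using assms by (intro mult_left_mono) auto
  also have "\<dots> = 2 * sin (x / 2) * cos (x / 2)" using z by simp
  also have "\<dots> = sin x" using sin_double[of "x / 2"] by simp
  finally show ?thesis by simp
qed simp

text \<open>The left side is half a harmonic mean of b/m and 1 - b/m, hence at most their minimum
  \<open>c\<close>, and |e(b/m) - 1| / 2 = |sin(\<pi> b/m)| is at least \<open>c\<close>. The
  reciprocals appear as a sum, not a maximum, so that they can later be summed over b.\<close>

lemma norm_root_char_minus_1_ge:
  assumes "0 < b" "b < m"
  shows "1 / (real m * (1 / real b + 1 / real (m - b))) \<le> norm (root_char m (int b) - 1) / 2"
proof -
  define x where "x = pi * (real b / real m)"
  have x: "0 \<le> x" "x \<le> pi"
    using assms by (auto simp: x_def field_simps)
  have s: "norm (root_char m (int b) - 1) = 2 * \<bar>sin x\<bar>"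
    using dist_exp_i_1[of "2 * x"] by (simp add: root_char_def cis_conv_exp x_def mult_ac)
  define c where "c = min (real b / real m) (real (m - b) / real m)"
  have c0: "c > 0" using assms by (auto simp: c_def)
  have mb: "real (m - b) / real m = 1 - real b / real m"
    using assms by (simp add: of_nat_diff field_simps)
  have "c \<le> sin x"
  proof (cases "x \<le> pi / 2")
    case True
    \<comment> \<open>An identity in disguise: x/2 exceeds b/m by (b/m)(\<pi>/2 - 1), which is
      nonnegative because \<pi> > 2.\<close>
    have "real b / real m \<le> x / 2 * 1 + real b / real m * (1 - pi / 2)"
      unfolding x_def by (simp add: algebra_simps)
    also have "\<dots> \<le> x / 2"
      using mult_nonneg_nonpos[OF divide_nonneg_nonneg[OF of_nat_0_le_iff of_nat_0_le_iff, of b m], of "1 - pi / 2"]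
        pi_gt3 by linarith
    also have "\<dots> \<le> sin x" using sin_ge_half[OF x(1) True] .
    finally show ?thesis by (simp add: c_def)
  next
    case False
    have "(1 - real b / real m) * (1 - pi / 2) \<le> 0"
      using assms pi_gt3 by (intro mult_nonneg_nonpos) auto
    then have rest: "y + (1 - real b / real m) * (1 - pi / 2) \<le> y" for y
      by linarith
    have "1 - real b / real m \<le> (pi - x) / 2 + (1 - real b / real m) * (1 - pi / 2)"
      unfolding x_def by (simp add: algebra_simps diff_divide_distrib)
    also have "\<dots> \<le> (pi - x) / 2"
      by (rule rest)
    also have "\<dots> \<le> sin (pi - x)" using False x by (intro sin_ge_half) auto
    finally show ?thesis by (simp add: c_def mb)
  qed
  moreover have "1 / (real m * (1 / real b + 1 / real (m - b))) \<le> c"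
  proof -
    define Q where "Q = real m * (1 / real b + 1 / real (m - b))"
    have "1 / c \<le> Q"
      using assms by (auto simp: Q_def c_def min_def distrib_left)
    then have "inverse Q \<le> inverse (1 / c)"
      using c0 by (intro le_imp_inverse_le) auto
    then show ?thesis
      by (simp add: inverse_eq_divide flip: Q_def)
  qed
  ultimately show ?thesis using s by simp
qed

text \<open>A geometric sum with ratio z on the unit circle has modulus at most 2 / |z - 1|,
  whatever its length K.\<close>

lemma norm_sum_root_char_le:
  assumes "0 < b" "b < m"
  shows "norm (\<Sum>u\<in>{1..K}. root_char m (- (int b * int u))) \<le> real m * (1 / real b + 1 / real (m - b))"
proof -
  define z where "z = root_char m (int b)"
  define Q where "Q = real m * (1 / real b + 1 / real (m - b))"
  have Q: "Q > 0" using assms by (auto simp: Q_def intro!: mult_pos_pos add_pos_pos)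
  have z: "1 / Q \<le> norm (z - 1) / 2"
    using norm_root_char_minus_1_ge[OF assms] by (simp add: Q_def z_def)
  have z1: "norm (z - 1) > 0"
  proof -
    have "0 < 1 / Q" using Q by simp
    then show ?thesis using z by linarith
  qed
  have "(\<Sum>u\<in>{1..K}. root_char m (- (int b * int u))) = (\<Sum>u\<in>{1..K}. cnj (z ^ u))"
    by (intro sum.cong refl) (simp add: z_def root_char_nat_mult[symmetric] cnj_root_char mult_ac)
  also have "\<dots> = cnj (\<Sum>u\<in>{1..K}. z ^ u)" by simp
  also have "norm \<dots> = norm (\<Sum>u\<in>{1..K}. z ^ u)" by (rule complex_mod_cnj)
  also have "(\<Sum>u\<in>{1..K}. z ^ u) = z * (\<Sum>u<K. z ^ u)"
    by (simp add: sum.atLeast_Suc_atMost_Suc_shift[of _ 0 "K - 1"] sum_distrib_left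
        sum.atLeast1_atMost_eq)
  also have "\<dots> = z * ((z ^ K - 1) / (z - 1))"
    using z1 by (subst geometric_sum) auto
  also have "norm \<dots> = norm (z ^ K - 1) / norm (z - 1)"
    by (simp add: norm_mult norm_divide z_def)
  also have "\<dots> \<le> 2 / norm (z - 1)"
    using norm_triangle_ineq4[of "z ^ K" 1]
    by (intro divide_right_mono) (auto simp: norm_power z_def)
  also have "\<dots> \<le> Q"
    using z z1 Q by (simp add: field_simps)
  finally show ?thesis by (simp add: Q_def)
qed

text \<open>The difference between the harmonic number and the logarithm decreases and equals 1 at m
  = 1.\<close>

lemma harm_le_one_plus_ln:
  assumes "m > 0"
  shows "harm m \<le> 1 + ln (real m)"
proof -
  obtain n where n: "m = Suc n" using assms by (cases m) auto
  have "harm (Suc n) - ln (real (Suc n)) \<le> harm (Suc 0) - ln (real (Suc 0))"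
    using decseq_harm_diff_ln by (rule decseqD) simp
  moreover have "harm (Suc 0) - ln (real (Suc 0)) = (1::real)"
    by (simp add: harm_def)
  ultimately show ?thesis unfolding n by linarith
qed

text \<open>The L1 norm of the kernel over the nonzero frequencies, the source of the logarithm in
  completion. The symmetry b -> m - b makes the two reciprocal sums equal.\<close>

lemma sum_norm_sum_root_char_le:
  assumes "m > 0"
  shows "(\<Sum>b\<in>{1..<m}. norm (\<Sum>u\<in>{1..K}. root_char m (- (int b * int u)))) \<le> 2 * real m * (1 + ln (real m))"
proof -
  have "(\<Sum>b\<in>{1..<m}. norm (\<Sum>u\<in>{1..K}. root_char m (- (int b * int u))))
      \<le> (\<Sum>b\<in>{1..<m}. real m * (1 / real b + 1 / real (m - b)))"
    by (intro sum_mono norm_sum_root_char_le) auto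
  also have "\<dots> = real m * ((\<Sum>b\<in>{1..<m}. 1 / real b) + (\<Sum>b\<in>{1..<m}. 1 / real (m - b)))"
    by (simp add: sum_distrib_left sum.distrib distrib_left)
  also have "(\<Sum>b\<in>{1..<m}. 1 / real (m - b)) = (\<Sum>b\<in>{1..<m}. 1 / real b)"
    by (rule sum.reindex_bij_witness[of _ "\<lambda>b. m - b" "\<lambda>b. m - b"]) auto
  finally have 1: "(\<Sum>b\<in>{1..<m}. norm (\<Sum>u\<in>{1..K}. root_char m (- (int b * int u))))
      \<le> real m * (2 * (\<Sum>b\<in>{1..<m}. 1 / real b))" by simp
  have "(\<Sum>b\<in>{1..<m}. 1 / real b) \<le> harm m"
    unfolding harm_def by (auto simp: field_simps intro!: sum_mono2)
  also have "harm m \<le> 1 + ln (real m)"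
    using assms by (rule harm_le_one_plus_ln)
  finally have "real m * (2 * (\<Sum>b\<in>{1..<m}. 1 / real b)) \<le> real m * (2 * (1 + ln (real m)))"
    by (intro mult_left_mono) auto
  with 1 show ?thesis by (simp only: mult_ac)
qed

text \<open>Fourier inversion modulo m turns the sum over {1..K} into a pairing of the transform
  \<open>F\<close> with the kernel \<open>G\<close>. Frequency 0 yields the expected share K/m of
  the complete sum; the others cost at most B times the L1 norm of the kernel. No relation between K
  and m is assumed.\<close>

lemma sum_completion:
  fixes f :: "nat \<Rightarrow> complex"
  assumes m: "m > 0" and per: "\<And>u. f u = f (u mod m)"
    and B: "\<And>b. b \<in> {1..<m} \<Longrightarrow> norm (\<Sum>w<m. f w * root_char m (int b * int w)) \<le> B" and B0: "B \<ge> 0"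
  shows "norm ((\<Sum>u\<in>{1..K}. f u) - of_nat K / of_nat m * (\<Sum>w<m. f w)) \<le> 2 * (1 + ln (real m)) * B"
proof -
  define G where "G b = (\<Sum>u\<in>{1..K}. root_char m (- (int b * int u)))" for b
  define F where "F b = (\<Sum>w<m. f w * root_char m (int b * int w))" for b
  have inv: "of_nat m * f u = (\<Sum>b<m. root_char m (- (int b * int u)) * F b)" for u
  proof -
    have "(\<Sum>b<m. root_char m (- (int b * int u)) * F b)
        = (\<Sum>b<m. \<Sum>w<m. f w * root_char m (int b * (int w - int u)))"
      by (intro sum.cong refl)
        (simp add: F_def sum_distrib_left root_char_add[symmetric] algebra_simps)
    also have "\<dots> = (\<Sum>w<m. f w * (\<Sum>b<m. root_char m (int b * (int w - int u))))"
      by (subst sum.swap) (simp add: sum_distrib_left)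
    \<comment> \<open>Orthogonality leaves only the representative of u in the period.\<close>
    also have "\<dots> = (\<Sum>w<m. if w = u mod m then of_nat m * f w else 0)"
    proof (intro sum.cong refl)
      fix w assume "w \<in> {..<m}"
      then have "int m dvd int w - int u \<longleftrightarrow> w = u mod m"
        by (metis cong_def cong_iff_dvd_diff cong_int_iff lessThan_iff mod_less)
      then show "f w * (\<Sum>b<m. root_char m (int b * (int w - int u))) = (if w = u mod m then of_nat m * f w else 0)"
        using m by (simp add: sum_root_char)
    qed
    also have "\<dots> = of_nat m * f (u mod m)"
      using m by (simp add: sum.delta')
    finally show ?thesis using per[of u] by simp
  qed
  have "of_nat m * (\<Sum>u\<in>{1..K}. f u) = (\<Sum>b<m. G b * F b)"
    by (simp add: sum_distrib_left inv sum.swap[of _ "{..<m}"] G_def sum_distrib_right)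
  also have "\<dots> = G 0 * F 0 + (\<Sum>b\<in>{1..<m}. G b * F b)"
    using m by (simp add: lessThan_atLeast0 sum.atLeast_Suc_lessThan)
  also have "G 0 * F 0 = of_nat K * (\<Sum>w<m. f w)"
    by (simp add: G_def F_def)
  finally have *: "of_nat m * ((\<Sum>u\<in>{1..K}. f u) - of_nat K / of_nat m * (\<Sum>w<m. f w)) = (\<Sum>b\<in>{1..<m}. G b * F b)"
    using m by (simp add: algebra_simps)
  have "real m * norm ((\<Sum>u\<in>{1..K}. f u) - of_nat K / of_nat m * (\<Sum>w<m. f w)) = norm (\<Sum>b\<in>{1..<m}. G b * F b)"
    using * by (metis norm_mult norm_of_nat)
  also have "\<dots> \<le> (\<Sum>b\<in>{1..<m}. norm (G b) * B)"
    by (rule order_trans[OF norm_sum])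
      (auto simp: norm_mult F_def intro!: sum_mono mult_left_mono B)
  also have "\<dots> = (\<Sum>b\<in>{1..<m}. norm (G b)) * B"
    by (simp add: sum_distrib_right)
  also have "\<dots> \<le> (2 * real m * (1 + ln (real m))) * B"
    unfolding G_def by (intro mult_right_mono sum_norm_sum_root_char_le m B0)
  also have "\<dots> = real m * (2 * (1 + ln (real m)) * B)" by simp
  finally show ?thesis using m by (simp only: mult_le_cancel_left_pos of_nat_0_less_iff)
qed

section \<open>Exponential sums over the powers of a residue\<close>

lemma sum_periodic_shift:
  fixes F :: "nat \<Rightarrow> 'a :: comm_ring_1"
  assumes "\<And>w. F (w + T) = F w"
  shows "(\<Sum>w<T. F (w + j)) = (\<Sum>w<T. F w)"
proof (induction j)
  case (Suc j)
  have "(\<Sum>w<T. F (w + Suc j)) = (\<Sum>w<Suc T. F (w + j)) - F j"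
    by (subst sum.lessThan_Suc_shift) simp
  also have "\<dots> = (\<Sum>w<T. F (w + j)) + F (T + j) - F j" by simp
  also have "F (T + j) = F j" using assms[of j] by (simp add: add.commute)
  finally show ?case using Suc by simp
qed simp

text \<open>A second moment: on expanding the square, summation over l forces \<open>h ^ w\<close>
  and \<open>h ^ w'\<close> to agree modulo p, so by injectivity only w = w' survives, where the
  twist by the character modulo T cancels.\<close>

lemma sum_norm_exp_char_squared:
  fixes p T b h :: nat
  assumes p: "p > 0" and inj: "inj_on (\<lambda>w. h ^ w mod p) {..<T}"
  defines "S \<equiv> \<lambda>l::nat. \<Sum>w<T. root_char p (int (l * h ^ w)) * root_char T (int b * int w)"
  shows "(\<Sum>l<p. (norm (S l))\<^sup>2) = real p * real T"
proof -
  define E where "E w = root_char T (int b * int w)" for w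
  have nE: "E w * cnj (E w) = 1" for w
    by (simp add: complex_norm_square[symmetric] E_def)
  have "(\<Sum>l<p. of_real ((norm (S l))\<^sup>2)) = (\<Sum>l<p. S l * cnj (S l))"
    by (intro sum.cong refl complex_norm_square)
  also have "\<dots> = (\<Sum>l<p. \<Sum>w<T. \<Sum>w'<T. E w * cnj (E w') * root_char p (int l * (int (h ^ w) - int (h ^ w'))))"
  proof (intro sum.cong refl)
    fix l
    have "root_char p (int l * (x - y)) = root_char p (int l * x) * cnj (root_char p (int l * y))" for x y
      by (simp add: cnj_root_char root_char_add[symmetric] algebra_simps)
    then show "S l * cnj (S l) = (\<Sum>w<T. \<Sum>w'<T. E w * cnj (E w') * root_char p (int l * (int (h ^ w) - int (h ^ w'))))"
      by (simp add: S_def E_def sum_product mult_ac)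
  qed
  also have "\<dots> = (\<Sum>w<T. \<Sum>w'<T. E w * cnj (E w') * (\<Sum>l<p. root_char p (int l * (int (h ^ w) - int (h ^ w')))))"
    by (simp add: sum_distrib_left sum.swap[of _ "{..<p}"])
  also have "\<dots> = (\<Sum>w<T. \<Sum>w'<T. if w' = w then of_nat p else 0)"
  proof (intro sum.cong refl)
    fix w w' assume "w \<in> {..<T}" "w' \<in> {..<T}"
    then have "int p dvd int (h ^ w) - int (h ^ w') \<longleftrightarrow> w' = w"
      using inj by (metis cong_def cong_iff_dvd_diff cong_int_iff inj_onD)
    then show "E w * cnj (E w') * (\<Sum>l<p. root_char p (int l * (int (h ^ w) - int (h ^ w')))) = (if w' = w then of_nat p else 0)"
      using p nE[of w] by (auto simp: sum_root_char)
  qed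
  also have "\<dots> = of_nat p * of_nat T"
    by (simp add: sum.delta)
  finally have "complex_of_real (\<Sum>l<p. (norm (S l))\<^sup>2) = complex_of_real (real p * real T)"
    by simp
  then show ?thesis by (simp only: of_real_eq_iff)
qed

lemma pow_inj_on_ord:
  fixes p h :: nat
  assumes "coprime p h"
  shows "inj_on (\<lambda>w. h ^ w mod p) {..<ord p h}"
proof (rule inj_onI)
  fix x y assume "x \<in> {..<ord p h}" "y \<in> {..<ord p h}" "h ^ x mod p = h ^ y mod p"
  then show "x = y"
    using order_divides_expdiff[OF assms, of x y] by (simp add: cong_def)
qed

text \<open>Replacing l by \<open>l * h ^ j\<close> shifts w and multiplies the sum by a phase, so
  its modulus is the same at T distinct residues. The second moment p T over all residues then
  bounds T |S l|^2.\<close>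

lemma norm_exp_char_sum_le_sqrt:
  fixes p h b l :: nat
  assumes p: "prime p" and h: "coprime p h" and l: "coprime l p"
  shows "norm (\<Sum>w<ord p h. root_char p (int (l * h ^ w)) * root_char (ord p h) (int b * int w)) \<le> sqrt (real p)"
proof -
  define T where "T = ord p h"
  have T0: "T > 0" using h by (simp add: T_def)
  have p0: "p > 0" using p prime_gt_0_nat by auto
  define S where "S l = (\<Sum>w<T. root_char p (int (l * h ^ w)) * root_char T (int b * int w))" for l :: nat
  have S_mod: "S (k mod p) = S k" for k
    unfolding S_def
  proof (intro sum.cong refl arg_cong2[of _ _ _ _ "(*)"] root_char_cong[OF p0])
    show "[int (k mod p * h ^ w) = int (k * h ^ w)] (mod int p)" for w
      unfolding cong_int_iff by (simp add: cong_def mod_mult_left_eq)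
  qed
  have S_shift: "norm (S (l * h ^ j)) = norm (S l)" for j
  proof -
    define F where "F w = root_char p (int (l * h ^ w)) * root_char T (int b * int w)" for w
    have per: "F (w + T) = F w" for w
    proof -
      have "[h ^ T = 1] (mod p)" unfolding T_def by (rule ord)
      then have "[l * h ^ w * h ^ T = l * h ^ w * 1] (mod p)" by (rule cong_scalar_left)
      then have "[int (l * h ^ (w + T)) = int (l * h ^ w)] (mod int p)"
        by (simp only: cong_int_iff power_add mult.assoc mult_1_right)
      moreover have "[int b * int (w + T) = int b * int w] (mod int T)"
        by (simp add: cong_iff_dvd_diff algebra_simps)
      ultimately show ?thesis
        unfolding F_def using p0 T0 by (metis root_char_cong)
    qed
    have "S (l * h ^ j) = root_char T (- (int b * int j)) * (\<Sum>w<T. F (w + j))"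
      unfolding S_def F_def sum_distrib_left
    proof (intro sum.cong refl)
      fix w
      have "root_char T (int b * int w) = root_char T (- (int b * int j)) * root_char T (int b * int (w + j))"
        by (simp add: root_char_add[symmetric] algebra_simps)
      moreover have "l * h ^ j * h ^ w = l * h ^ (w + j)"
        by (simp add: power_add mult_ac)
      ultimately show "root_char p (int (l * h ^ j * h ^ w)) * root_char T (int b * int w) =
         root_char T (- (int b * int j)) * (root_char p (int (l * h ^ (w + j))) * root_char T (int b * int (w + j)))"
        by (metis mult.left_commute)
    qed
    also have "(\<Sum>w<T. F (w + j)) = S l"
      using sum_periodic_shift[of F T j] per by (simp add: F_def S_def)
    finally show ?thesis by (simp add: norm_mult)
  qed
  define orbit where "orbit = (\<lambda>j. l * h ^ j mod p) ` {..<T}"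
  have inj: "inj_on (\<lambda>j. l * h ^ j mod p) {..<T}"
  proof (rule inj_onI)
    fix x y assume xy: "x \<in> {..<T}" "y \<in> {..<T}" "l * h ^ x mod p = l * h ^ y mod p"
    then have "[h ^ x = h ^ y] (mod p)"
      using cong_mult_lcancel_nat[OF l] by (simp add: cong_def)
    then show "x = y"
      using pow_inj_on_ord[OF h] xy by (auto simp: inj_on_def cong_def T_def)
  qed
  \<comment> \<open>Only the orbit of l is kept out of the complete second moment; its T members
    contribute equally.\<close>
  have "real T * (norm (S l))\<^sup>2 = (\<Sum>j<T. (norm (S (l * h ^ j mod p)))\<^sup>2)"
    by (simp add: S_mod S_shift)
  also have "\<dots> = (\<Sum>k\<in>orbit. (norm (S k))\<^sup>2)"
    unfolding orbit_def by (simp add: sum.reindex[OF inj])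
  also have "\<dots> \<le> (\<Sum>k<p. (norm (S k))\<^sup>2)"
    using p0 by (intro sum_mono2) (auto simp: orbit_def)
  also have "\<dots> = real T * real p"
    unfolding S_def using sum_norm_exp_char_squared[OF p0, of h T b] pow_inj_on_ord[OF h]
    by (simp add: T_def)
  finally have "(norm (S l))\<^sup>2 \<le> real p"
    using T0 by simp
  then show ?thesis
    unfolding S_def T_def by (rule real_le_rsqrt)
qed

text \<open>Completion is applied twice: over the exponents modulo \<open>ord p h\<close> to bound the
  incomplete exponential sums, and over the values modulo \<open>p\<close> to count.\<close>

lemma norm_incomplete_exp_sum_le:
  fixes p h l K :: nat
  assumes p: "prime p" and h: "coprime p h" and l: "coprime l p" and K: "K \<le> ord p h"
  shows "norm (\<Sum>u\<in>{1..K}. root_char p (int (l * h ^ u))) \<le> (3 + 2 * ln (real p)) * sqrt (real p)"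
proof -
  define T where "T = ord p h"
  have T0: "T > 0" using h by (simp add: T_def)
  have p0: "p > 0" using p prime_gt_0_nat by auto
  have Tp: "T \<le> p"
    using order_divides_totient[of p h] h totient_le[of p] p0
    by (metis T_def coprime_commute dvd_imp_le le_trans totient_gt_0_iff)
  define f where "f u = root_char p (int (l * h ^ u))" for u
  have per: "f u = f (u mod T)" for u
  proof -
    have "[h ^ u = h ^ (u mod T)] (mod p)"
      using order_divides_expdiff[OF h] by (simp add: T_def cong_def)
    then have "[int (l * h ^ u) = int (l * h ^ (u mod T))] (mod int p)"
      unfolding cong_int_iff by (rule cong_scalar_left)
    then show ?thesis unfolding f_def by (rule root_char_cong[OF p0])
  qed
  have B: "norm (\<Sum>w<T. f w * root_char T (int b * int w)) \<le> sqrt (real p)" for b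
    using norm_exp_char_sum_le_sqrt[OF p h l, of b] by (simp add: f_def T_def)
  have 1: "norm ((\<Sum>u\<in>{1..K}. f u) - of_nat K / of_nat T * (\<Sum>w<T. f w)) \<le> 2 * (1 + ln (real T)) * sqrt (real p)"
    using T0 per B by (rule sum_completion) simp
  \<comment> \<open>Since K is at most T, the frequency 0 costs one more square root of p, which
    turns the constant 2 into 3.\<close>
  have 2: "norm (of_nat K / of_nat T * (\<Sum>w<T. f w)) \<le> 1 * sqrt (real p)"
    unfolding norm_mult using T0 K B[of 0]
    by (intro mult_mono) (auto simp: norm_divide T_def)
  have "norm (\<Sum>u\<in>{1..K}. f u) \<le> 2 * (1 + ln (real T)) * sqrt (real p) + 1 * sqrt (real p)"
    using norm_triangle_sub[of "\<Sum>u\<in>{1..K}. f u" "of_nat K / of_nat T * (\<Sum>w<T. f w)"] 1 2 by linarith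
  also have "\<dots> = (3 + 2 * ln (real T)) * sqrt (real p)" by (simp add: algebra_simps)
  also have "\<dots> \<le> (3 + 2 * ln (real p)) * sqrt (real p)"
    using T0 Tp by (intro mult_right_mono) auto
  finally show ?thesis by (simp add: f_def)
qed

text \<open>The number \<open>F v\<close> of exponents that hit v is periodic modulo p. Its Fourier
  coefficient at b is the incomplete exponential sum with l = b c, already bounded, and its sum over
  a period is K.\<close>

lemma card_exp_curve_box:
  fixes p h c K N :: nat
  assumes p: "prime p" and h: "coprime p h" and c: "coprime c p" and K: "K \<le> ord p h" and N: "N < p"
  shows "\<bar>real (card {(u, v) \<in> {1..K} \<times> {1..N}. [v = c * h ^ u] (mod p)}) - real K * real N / real p\<bar>
    \<le> sqrt (real p) * (3 + 2 * ln (real p))\<^sup>2"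
proof -
  have p0: "p > 0" using p prime_gt_0_nat by auto
  define F :: "nat \<Rightarrow> complex" where "F v = of_nat (card {u\<in>{1..K}. [v = c * h ^ u] (mod p)})" for v
  have Fsum: "F v = (\<Sum>u\<in>{1..K}. if [v = c * h ^ u] (mod p) then 1 else 0)" for v
    by (simp add: F_def sum.If_cases Int_def)
  have hat: "(\<Sum>v<p. F v * root_char p (int b * int v)) = (\<Sum>u\<in>{1..K}. root_char p (int ((b * c) * h ^ u)))" for b
  proof -
    have "(\<Sum>v<p. F v * root_char p (int b * int v))
        = (\<Sum>v<p. \<Sum>u\<in>{1..K}. if v = c * h ^ u mod p then root_char p (int b * int v) else 0)"
      unfolding Fsum sum_distrib_right by (intro sum.cong refl) (auto simp: cong_def)
    also have "\<dots> = (\<Sum>u\<in>{1..K}. \<Sum>v<p. if v = c * h ^ u mod p then root_char p (int b * int v) else 0)"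
      by (rule sum.swap)
    also have "\<dots> = (\<Sum>u\<in>{1..K}. root_char p (int b * int (c * h ^ u mod p)))"
      using p0 by (intro sum.cong refl) (simp add: sum.delta')
    also have "\<dots> = (\<Sum>u\<in>{1..K}. root_char p (int ((b * c) * h ^ u)))"
    proof (intro sum.cong refl root_char_cong[OF p0])
      fix u
      have "[b * (c * h ^ u mod p) = b * (c * h ^ u)] (mod p)"
        by (intro cong_scalar_left) (simp add: cong_def)
      then show "[int b * int (c * h ^ u mod p) = int (b * c * h ^ u)] (mod int p)"
        by (metis cong_int_iff mult.assoc of_nat_mult)
    qed
    finally show ?thesis .
  qed
  have bd: "norm (\<Sum>v<p. F v * root_char p (int b * int v)) \<le> (3 + 2 * ln (real p)) * sqrt (real p)"
    if "b \<in> {1..<p}" for b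
  proof -
    have "coprime (b * c) p"
      using that c p by (metis atLeastLessThan_iff coprime_commute coprime_mult_left_iff nat_dvd_not_less
          not_one_le_zero prime_imp_coprime_nat zero_less_iff_neq_zero)
    then show ?thesis
      unfolding hat by (rule norm_incomplete_exp_sum_le[OF p h _ K])
  qed
  have lnp: "0 \<le> ln (real p)" using p0 by simp
  have "norm ((\<Sum>v\<in>{1..N}. F v) - of_nat N / of_nat p * (\<Sum>v<p. F v))
      \<le> 2 * (1 + ln (real p)) * ((3 + 2 * ln (real p)) * sqrt (real p))"
    using p0 _ bd by (rule sum_completion) (use lnp in \<open>auto simp: F_def cong_def\<close>)
  also have "(\<Sum>v<p. F v) = of_nat K"
    using hat[of 0] by simp
  also have "(\<Sum>v\<in>{1..N}. F v) = of_nat (card (SIGMA v:{1..N}. {u\<in>{1..K}. [v = c * h ^ u] (mod p)}))"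
    by (simp add: F_def)
  also have "card (SIGMA v:{1..N}. {u\<in>{1..K}. [v = c * h ^ u] (mod p)})
      = card {(u, v) \<in> {1..K} \<times> {1..N}. [v = c * h ^ u] (mod p)}" (is "_ = card ?A")
    by (rule bij_betw_same_card[of prod.swap]) (auto simp: bij_betw_def inj_on_def image_def)
  also have "complex_of_nat (card ?A) - of_nat N / of_nat p * of_nat K
      = complex_of_real (real (card ?A) - real K * real N / real p)"
    by simp
  also have "norm \<dots> = \<bar>real (card ?A) - real K * real N / real p\<bar>"
    by (rule norm_of_real)
  also have "2 * (1 + ln (real p)) * ((3 + 2 * ln (real p)) * sqrt (real p))
      = sqrt (real p) * ((2 + 2 * ln (real p)) * (3 + 2 * ln (real p)))"
    by (simp add: algebra_simps)
  also have "\<dots> \<le> sqrt (real p) * ((3 + 2 * ln (real p)) * (3 + 2 * ln (real p)))"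
    using lnp by (intro mult_left_mono mult_right_mono) auto
  finally show ?thesis by (simp add: power2_eq_square)
qed

section \<open>Counting coincidences\<close>

text \<open>A curve point (x, y) with both coordinates divisible by d is stored through its
  quotients u = x/d, v = y/d; the cardinality is the \<open>M\<^sub>d\<close> of the
  overview.\<close>

definition multiple_points :: "nat \<Rightarrow> nat \<Rightarrow> nat \<Rightarrow> nat \<Rightarrow> nat \<Rightarrow> nat \<Rightarrow> (nat \<times> nat) set" where
  "multiple_points p a g K N d =
     {(u, v) \<in> {1..K div d} \<times> {1..N div d}. [d * v = a * g ^ (d * u)] (mod p)}"

lemma finite_multiple_points [simp]: "finite (multiple_points p a g K N d)"
  unfolding multiple_points_def by (rule finite_subset[of _ "{1..K div d} \<times> {1..N div d}"]) auto

lemma coprime_less_prime: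
  fixes p d :: nat
  assumes "prime p" "0 < d" "d < p"
  shows "coprime d p"
  using assms by (metis coprime_commute nat_dvd_not_less prime_imp_coprime_nat)

text \<open>With e the inverse of d modulo p, the condition reads v = a e (g^d)^u modulo p: again an
  exponential curve, with multiplier a e and base g^d.\<close>

lemma card_multiple_points:
  assumes p: "prime p" and g: "coprime p g" and a: "coprime a p" and K: "K \<le> ord p g" and N: "N < p"
    and d: "0 < d" "d < p"
  shows "\<bar>real (card (multiple_points p a g K N d)) - real (K div d) * real (N div d) / real p\<bar>
    \<le> sqrt (real p) * (3 + 2 * ln (real p))\<^sup>2"
proof -
  have dp: "coprime d p" using p d by (rule coprime_less_prime)
  obtain e where e: "[d * e = 1] (mod p)"
    using cong_solve_coprime_nat[OF dp] by auto
  have ep: "coprime e p"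
    using e by (metis cong_imp_coprime cong_sym coprime_1_left coprime_mult_left_iff)
  have "coprime (a * e) p" using a ep by simp
  moreover have "coprime p (g ^ d)" using g by simp
  \<comment> \<open>The order of g divides d times the order of g^d, so passing to g^d shortens the
    period by a factor of at most d.\<close>
  moreover have "K div d \<le> ord p (g ^ d)"
  proof -
    have "[g ^ (d * ord p (g ^ d)) = 1] (mod p)"
      using ord[of "g ^ d" p] by (simp only: power_mult)
    then have "ord p g dvd d * ord p (g ^ d)"
      by (simp only: ord_divides)
    moreover have "0 < d * ord p (g ^ d)" using g d by simp
    ultimately have "ord p g \<le> d * ord p (g ^ d)" by (rule dvd_imp_le)
    with K have "K \<le> d * ord p (g ^ d)" by linarith
    then have "K div d \<le> d * ord p (g ^ d) div d" by (rule div_le_mono)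
    then show ?thesis using d by simp
  qed
  moreover have "N div d < p" using N by (meson div_le_dividend le_less_trans)
  ultimately have "\<bar>real (card {(u, v) \<in> {1..K div d} \<times> {1..N div d}. [v = a * e * (g ^ d) ^ u] (mod p)})
      - real (K div d) * real (N div d) / real p\<bar> \<le> sqrt (real p) * (3 + 2 * ln (real p))\<^sup>2"
    using p by (intro card_exp_curve_box)
  moreover have "[v = a * e * (g ^ d) ^ u] (mod p) \<longleftrightarrow> [d * v = a * g ^ (d * u)] (mod p)" for u v
  proof -
    have "[v = a * e * (g ^ d) ^ u] (mod p) \<longleftrightarrow> [d * v = d * (a * e * (g ^ d) ^ u)] (mod p)"
      using cong_mult_lcancel_nat[OF dp] by simp
    moreover have "[d * (a * e * (g ^ d) ^ u) = a * g ^ (d * u)] (mod p)"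
      using cong_scalar_right[OF e, of "a * g ^ (d * u)"] by (simp add: power_mult mult_ac)
    ultimately show ?thesis by (meson cong_sym cong_trans)
  qed
  ultimately show ?thesis by (simp add: multiple_points_def)
qed

section \<open>Coincidence counts and Cauchy's inequality\<close>

lemma card_coincidences_eq:
  assumes "finite S" "finite T" "\<alpha> ` S \<subseteq> T" "\<beta> ` S \<subseteq> T"
  shows "card {(x, y) \<in> S \<times> S. \<alpha> x = \<beta> y} = (\<Sum>t\<in>T. card {x\<in>S. \<alpha> x = t} * card {y\<in>S. \<beta> y = t})"
proof -
  have "{(x, y) \<in> S \<times> S. \<alpha> x = \<beta> y} = (\<Union>t\<in>T. {x\<in>S. \<alpha> x = t} \<times> {y\<in>S. \<beta> y = t})"
    using assms(3) by auto
  also have "card \<dots> = (\<Sum>t\<in>T. card ({x\<in>S. \<alpha> x = t} \<times> {y\<in>S. \<beta> y = t}))"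
    using assms by (intro card_UN_disjoint) auto
  finally show ?thesis by (simp add: card_cartesian_product)
qed

text \<open>Cauchy's inequality over the fibres of f: their sizes add up to |S|, and the squares of
  the sizes add up to the number of coincidences.\<close>

lemma card_power2_le_coincidences:
  assumes "finite S" "finite T" "f ` S \<subseteq> T"
  shows "(real (card S))\<^sup>2 \<le> real (card T) * real (card {(x, y) \<in> S \<times> S. f x = f y})"
proof -
  have "card S = (\<Sum>t\<in>T. card {x\<in>S. f x = t})"
    using assms by (subst card_UN_disjoint[symmetric]) (auto intro: arg_cong[of _ _ card])
  then have "(real (card S))\<^sup>2 = (\<Sum>t\<in>T. real (card {x\<in>S. f x = t}))\<^sup>2" by simp
  also have "\<dots> \<le> real (card T) * (\<Sum>t\<in>T. (real (card {x\<in>S. f x = t}))\<^sup>2)"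
    using sum_squared_le_sum_of_squares[of "\<lambda>t. real (card {x\<in>S. f x = t})" T] by (simp only: mult.commute)
  also have "(\<Sum>t\<in>T. (real (card {x\<in>S. f x = t}))\<^sup>2) = real (card {(x, y) \<in> S \<times> S. f x = f y})"
    using assms by (subst card_coincidences_eq[of S T]) (auto simp: power2_eq_square)
  finally show ?thesis .
qed

text \<open>With fibre sizes A t and B t, the left side is the sum of A t * B t, at most half the
  sum of their squares; each square sum counts coincidences of \<alpha> or of \<beta>, hence of f.
  This is the device that discards the factors d from a congruence.\<close>

lemma card_twisted_coincidences_le:
  assumes S: "finite S"
    and \<alpha>: "\<And>x y. x \<in> S \<Longrightarrow> y \<in> S \<Longrightarrow> \<alpha> x = \<alpha> y \<Longrightarrow> f x = f y"
    and \<beta>: "\<And>x y. x \<in> S \<Longrightarrow> y \<in> S \<Longrightarrow> \<beta> x = \<beta> y \<Longrightarrow> f x = f y"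
  shows "card {(x, y) \<in> S \<times> S. \<alpha> x = \<beta> y} \<le> card {(x, y) \<in> S \<times> S. f x = f y}"
proof -
  define T where "T = \<alpha> ` S \<union> \<beta> ` S"
  define A where "A t = real (card {x\<in>S. \<alpha> x = t})" for t
  define B where "B t = real (card {x\<in>S. \<beta> x = t})" for t
  have T: "finite T" "\<alpha> ` S \<subseteq> T" "\<beta> ` S \<subseteq> T" using S by (auto simp: T_def)
  have fin: "finite {(x, y) \<in> S \<times> S. P x y}" for P
    by (rule finite_subset[of _ "S \<times> S"]) (use S in auto)
  have AA: "(\<Sum>t\<in>T. A t * A t) \<le> real (card {(x, y) \<in> S \<times> S. f x = f y})"
  proof -
    have "(\<Sum>t\<in>T. A t * A t) = real (card {(x, y) \<in> S \<times> S. \<alpha> x = \<alpha> y})"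
      using S T by (subst card_coincidences_eq[of S T]) (auto simp: A_def)
    also have "\<dots> \<le> real (card {(x, y) \<in> S \<times> S. f x = f y})"
      using \<alpha> by (intro of_nat_mono card_mono fin) blast
    finally show ?thesis .
  qed
  have BB: "(\<Sum>t\<in>T. B t * B t) \<le> real (card {(x, y) \<in> S \<times> S. f x = f y})"
  proof -
    have "(\<Sum>t\<in>T. B t * B t) = real (card {(x, y) \<in> S \<times> S. \<beta> x = \<beta> y})"
      using S T by (subst card_coincidences_eq[of S T]) (auto simp: B_def)
    also have "\<dots> \<le> real (card {(x, y) \<in> S \<times> S. f x = f y})"
      using \<beta> by (intro of_nat_mono card_mono fin) blast
    finally show ?thesis .
  qed
  have "real (card {(x, y) \<in> S \<times> S. \<alpha> x = \<beta> y}) = (\<Sum>t\<in>T. A t * B t)"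
    using S T by (subst card_coincidences_eq[of S T]) (auto simp: A_def B_def)
  also have "\<dots> \<le> (\<Sum>t\<in>T. (A t * A t + B t * B t) / 2)"
  proof (intro sum_mono)
    fix t show "A t * B t \<le> (A t * A t + B t * B t) / 2"
      using sum_squares_bound[of "A t" "B t"] by (simp add: power2_eq_square)
  qed
  also have "\<dots> = ((\<Sum>t\<in>T. A t * A t) + (\<Sum>t\<in>T. B t * B t)) / 2"
    by (simp add: sum.distrib sum_divide_distrib[symmetric])
  also have "\<dots> \<le> real (card {(x, y) \<in> S \<times> S. f x = f y})"
    using AA BB by simp
  finally show ?thesis by simp
qed

section \<open>Linear congruences and sums of greatest common divisors\<close>

lemma card_residue_class_le:
  fixes q X :: nat
  assumes "S \<subseteq> {..X}" "\<And>x y. x \<in> S \<Longrightarrow> y \<in> S \<Longrightarrow> [x = y] (mod q)"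
  shows "card S \<le> X div q + 1"
proof -
  have "inj_on (\<lambda>x. x div q) S"
    using assms(2) by (intro inj_onI) (metis cong_def div_mult_mod_eq)
  moreover have "(\<lambda>x. x div q) ` S \<subseteq> {..X div q}"
    using assms(1) by (auto intro: div_le_mono)
  ultimately show ?thesis using card_inj_on_le[of "\<lambda>x. x div q" S "{..X div q}"] by simp
qed

text \<open>Since d > 0, i determines j. Two solutions satisfy c (i - i') = d (j' - j), and
  cancelling the gcd puts all i into one class modulo d / gcd c d.\<close>

lemma card_line_points_le:
  fixes c d X m :: nat
  assumes d: "0 < d"
  shows "card {(i, j) \<in> {1..X} \<times> {1..X}. c * i + d * j = m} \<le> X div (d div gcd c d) + 1"
proof -
  define q where "q = d div gcd c d"
  let ?A = "{(i, j) \<in> {1..X} \<times> {1..X}. c * i + d * j = m}"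
  have "inj_on fst ?A" using d by (auto simp: inj_on_def)
  then have "card ?A = card (fst ` ?A)" by (simp add: card_image)
  also have "\<dots> \<le> X div q + 1"
  proof (rule card_residue_class_le)
    fix i i' assume "i \<in> fst ` ?A" "i' \<in> fst ` ?A"
    then have "\<exists>j. c * i + d * j = m" "\<exists>j. c * i' + d * j = m" by auto
    then obtain j j' where "c * i + d * j = m" "c * i' + d * j' = m" by blast
    then have "int c * int i + int d * int j = int c * int i' + int d * int j'"
      by (metis of_nat_add of_nat_mult)
    then have *: "int c * (int i - int i') = int d * (int j' - int j)"
      by (simp add: algebra_simps)
    define e where "e = gcd c d"
    have e: "e > 0" using d by (simp add: e_def)
    have cd: "c = e * (c div e)" "d = e * (d div e)" by (simp_all add: e_def)
    have "int e * (int (c div e) * (int i - int i')) = int e * (int (d div e) * (int j' - int j))"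
      using * cd by (metis mult.assoc of_nat_mult)
    then have "int (c div e) * (int i - int i') = int (d div e) * (int j' - int j)"
      using e by simp
    then have "int (d div e) dvd int (c div e) * (int i - int i')" by simp
    moreover have "coprime (int (d div e)) (int (c div e))"
      using div_gcd_coprime[of c d] d by (simp add: e_def coprime_commute)
    ultimately have "int (d div e) dvd int i - int i'"
      using coprime_dvd_mult_right_iff by blast
    then show "[i = i'] (mod q)"
      by (metis cong_iff_dvd_diff cong_int_iff e_def q_def)
  qed auto
  finally show ?thesis by (simp add: q_def)
qed

text \<open>The linear form stays below M t, so the congruence splits into at most M equations, one
  for each admissible value m.\<close>

lemma card_cong_line_points_le:
  fixes c d X s t M :: nat
  assumes d: "0 < d" and t: "0 < t" and M: "(c + d) * X < M * t"
  shows "card {(i, j) \<in> {1..X} \<times> {1..X}. [c * i + d * j = s] (mod t)} \<le> M * (X div (d div gcd c d) + 1)"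
proof -
  define A where "A m = {(i, j) \<in> {1..X} \<times> {1..X}. c * i + d * j = m}" for m
  define R where "R = {m. m < M * t \<and> [m = s] (mod t)}"
  have "inj_on (\<lambda>m. m div t) R"
    by (intro inj_onI) (metis (mono_tags, lifting) R_def cong_def div_mult_mod_eq mem_Collect_eq)
  moreover have "(\<lambda>m. m div t) ` R \<subseteq> {..<M}"
    using t by (auto simp: R_def less_mult_imp_div_less)
  ultimately have "card R \<le> M"
    using card_inj_on_le[of "\<lambda>m. m div t" R "{..<M}"] by simp
  have finR: "finite R" by (rule finite_subset[of _ "{..<M * t}"]) (auto simp: R_def)
  have finA: "finite (A m)" for m
    by (rule finite_subset[of _ "{1..X} \<times> {1..X}"]) (auto simp: A_def)
  have "{(i, j) \<in> {1..X} \<times> {1..X}. [c * i + d * j = s] (mod t)} \<subseteq> (\<Union>m\<in>R. A m)"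
  proof safe
    fix i j assume ij: "i \<in> {1..X}" "j \<in> {1..X}" "[c * i + d * j = s] (mod t)"
    have "c * i + d * j \<le> c * X + d * X"
      using ij by (intro add_mono mult_le_mono2) auto
    then have "c * i + d * j \<in> R" using M ij by (simp add: R_def algebra_simps)
    then show "(i, j) \<in> (\<Union>m\<in>R. A m)" using ij by (auto simp: A_def)
  qed
  then have "card {(i, j) \<in> {1..X} \<times> {1..X}. [c * i + d * j = s] (mod t)} \<le> card (\<Union>m\<in>R. A m)"
    by (intro card_mono finite_UN_I finR finA)
  also have "\<dots> \<le> (\<Sum>m\<in>R. card (A m))" using finR by (rule card_UN_le)
  also have "\<dots> \<le> (\<Sum>m\<in>R. X div (d div gcd c d) + 1)"
    unfolding A_def using d by (intro sum_mono card_line_points_le)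
  also have "\<dots> \<le> M * (X div (d div gcd c d) + 1)"
    using \<open>card R \<le> M\<close> by (simp only: sum_constant of_nat_id mult_le_mono1)
  finally show ?thesis .
qed

lemma card_multiples_le: "card {d\<in>{1..X}. e dvd d} \<le> X div e" for X e :: nat
proof (cases "e = 0")
  case False
  have "inj_on (\<lambda>d. d div e) {d\<in>{1..X}. e dvd d}"
    by (intro inj_onI) (auto elim!: dvdE simp: False)
  moreover have "(\<lambda>d. d div e) ` {d\<in>{1..X}. e dvd d} \<subseteq> {1..X div e}"
    using False by (auto simp: less_eq_div_iff_mult_less_eq mult.commute elim!: dvdE)
  ultimately show ?thesis
    using card_inj_on_le[of "\<lambda>d. d div e" _ "{1..X div e}"] by simp
qed auto

text \<open>The gcd is bounded by the sum of all common divisors e. Each e divides at most X/e of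
  the numbers up to X, so it contributes at most e (X/e)^2 = X^2 / e.\<close>

lemma sum_gcd_le: "(\<Sum>c\<in>{1..X}. \<Sum>d\<in>{1..X}. real (gcd c d)) \<le> (real X)\<^sup>2 * harm X" for X :: nat
proof -
  have "(\<Sum>c\<in>{1..X}. \<Sum>d\<in>{1..X}. real (gcd c d))
      \<le> (\<Sum>c\<in>{1..X}. \<Sum>d\<in>{1..X}. \<Sum>e\<in>{1..X}. if e dvd c \<and> e dvd d then real e else 0)"
  proof (intro sum_mono)
    fix c d assume cd: "c \<in> {1..X}" "d \<in> {1..X}"
    have "gcd c d \<le> c" using cd by (intro gcd_le1_nat) auto
    moreover have "0 < gcd c d" using cd by simp
    ultimately have "gcd c d \<in> {1..X}" using cd unfolding atLeastAtMost_iff by linarith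
    moreover have "(if gcd c d dvd c \<and> gcd c d dvd d then real (gcd c d) else 0) = real (gcd c d)"
      by simp
    ultimately show "real (gcd c d) \<le> (\<Sum>e\<in>{1..X}. if e dvd c \<and> e dvd d then real e else 0)"
      using member_le_sum[of "gcd c d" "{1..X}" "\<lambda>e. if e dvd c \<and> e dvd d then real e else 0"] by simp
  qed
  also have "\<dots> = (\<Sum>c\<in>{1..X}. \<Sum>e\<in>{1..X}. \<Sum>d\<in>{1..X}. if e dvd c \<and> e dvd d then real e else 0)"
    by (intro sum.cong refl sum.swap)
  also have "\<dots> = (\<Sum>e\<in>{1..X}. \<Sum>c\<in>{1..X}. \<Sum>d\<in>{1..X}. if e dvd c \<and> e dvd d then real e else 0)"
    by (rule sum.swap)
  also have "\<dots> = (\<Sum>e\<in>{1..X}. \<Sum>c\<in>{1..X}. \<Sum>d\<in>{1..X}. real e * ((if e dvd c then 1 else 0) * (if e dvd d then 1 else 0)))"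
    by (intro sum.cong refl) auto
  also have "\<dots> = (\<Sum>e\<in>{1..X}. real e * (real (card {d\<in>{1..X}. e dvd d}))\<^sup>2)"
    by (simp add: sum_distrib_left[symmetric] sum_distrib_right[symmetric] sum.If_cases power2_eq_square Int_def)
  also have "\<dots> \<le> (\<Sum>e\<in>{1..X}. (real X)\<^sup>2 * inverse (real e))"
  proof (intro sum_mono)
    fix e assume e: "e \<in> {1..X}"
    have "real (card {d\<in>{1..X}. e dvd d}) \<le> real (X div e)"
      using card_multiples_le by (rule of_nat_mono)
    also have "\<dots> \<le> real X / real e" by (rule of_nat_div_le_of_nat)
    finally have "real e * (real (card {d\<in>{1..X}. e dvd d}))\<^sup>2 \<le> real e * (real X / real e)\<^sup>2"
      by (intro mult_left_mono power_mono) auto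
    also have "\<dots> = (real X)\<^sup>2 * inverse (real e)"
      using e by (simp add: power2_eq_square field_simps)
    finally show "real e * (real (card {d\<in>{1..X}. e dvd d}))\<^sup>2 \<le> (real X)\<^sup>2 * inverse (real e)" .
  qed
  also have "\<dots> = (real X)\<^sup>2 * harm X" by (simp add: harm_def sum_distrib_left)
  finally show ?thesis .
qed

section \<open>Points with a common divisor in a dyadic range\<close>

text \<open>A dependent sum instead of a union: a point is kept once for every d, so the cardinality
  is the sum of the \<open>M\<^sub>d\<close>.\<close>

definition dyadic_points :: "nat \<Rightarrow> nat \<Rightarrow> nat \<Rightarrow> nat \<Rightarrow> nat \<Rightarrow> nat \<Rightarrow> (nat \<times> nat \<times> nat) set" where
  "dyadic_points p a g K N \<Delta> = (SIGMA d:{\<Delta>..<2 * \<Delta>}. multiple_points p a g K N d)"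

lemma finite_dyadic_points [simp]: "finite (dyadic_points p a g K N \<Delta>)"
  unfolding dyadic_points_def by auto

lemma card_dyadic_points: "card (dyadic_points p a g K N \<Delta>) = (\<Sum>d\<in>{\<Delta>..<2 * \<Delta>}. card (multiple_points p a g K N d))"
  unfolding dyadic_points_def by simp

lemma dyadic_pointsD:
  assumes "(d, u, v) \<in> dyadic_points p a g K N \<Delta>" "\<Delta> > 0"
  shows "\<Delta> \<le> d" "d < 2 * \<Delta>" "1 \<le> u" "1 \<le> v" "d * u \<le> K" "d * v \<le> N" "d \<le> K" "u \<le> K div \<Delta>" "v \<le> N div \<Delta>"
    "[d * v = a * g ^ (d * u)] (mod p)"
proof -
  have *: "\<Delta> \<le> d" "d < 2 * \<Delta>" "1 \<le> u" "u \<le> K div d" "1 \<le> v" "v \<le> N div d" "[d * v = a * g ^ (d * u)] (mod p)"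
    using assms by (auto simp: dyadic_points_def multiple_points_def)
  then have d: "d > 0" using assms by linarith
  from * d have du: "d * u \<le> K" "d * v \<le> N"
    by (simp_all add: less_eq_div_iff_mult_less_eq mult.commute)
  moreover have "d \<le> d * u" using * by simp
  moreover have "K div d \<le> K div \<Delta>" "N div d \<le> N div \<Delta>"
    using * assms by (intro div_le_mono2; simp)+
  ultimately show "\<Delta> \<le> d" "d < 2 * \<Delta>" "1 \<le> u" "1 \<le> v" "d * u \<le> K" "d * v \<le> N" "d \<le> K" "u \<le> K div \<Delta>" "v \<le> N div \<Delta>"
    "[d * v = a * g ^ (d * u)] (mod p)"
    using * by linarith+
qed

section \<open>Coincidences between divisors for a fixed exponent\<close>

text \<open>Given \<open>k = d\<^sub>1 - d\<^sub>2 > 0\<close>, the congruence reads \<open>d\<^sub>2 (h\<^sup>k - 1) \<equiv> k\<close>, which determines \<open>d\<^sub>2\<close>.\<close>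

lemma card_diff_coincidences_le:
  fixes p h \<Delta> :: nat
  assumes p: "prime p" and h: "coprime h p" and D: "D \<subseteq> {\<Delta>..<2 * \<Delta>}" "\<And>d. d \<in> D \<Longrightarrow> d < p"
  shows "card {(c, d) \<in> D \<times> D. d < c \<and> [d * h ^ c = c * h ^ d] (mod p)} \<le> \<Delta>"
proof -
  let ?A = "{(c, d) \<in> D \<times> D. d < c \<and> [d * h ^ c = c * h ^ d] (mod p)}"
  have key: "int p dvd int d * (int h ^ k - 1) - int k"
    if "[d * h ^ (d + k) = (d + k) * h ^ d] (mod p)" for d k
  proof -
    have "[(d * h ^ k) * h ^ d = (d + k) * h ^ d] (mod p)"
      using that by (simp add: power_add mult_ac)
    then have "[d * h ^ k = d + k] (mod p)"
      using h cong_mult_rcancel_nat[of "h ^ d" p] by simp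
    then have "[int (d * h ^ k) = int (d + k)] (mod int p)"
      by (simp only: cong_int_iff)
    then show ?thesis
      by (simp add: cong_iff_dvd_diff algebra_simps)
  qed
  have "inj_on (\<lambda>(c, d). c - d) ?A"
  proof (rule inj_onI, safe)
    fix c d c' d' assume D': "c \<in> D" "d \<in> D" "c' \<in> D" "d' \<in> D"
      and less: "d < c" "d' < c'" and eq: "c - d = c' - d'"
      and cd: "[d * h ^ c = c * h ^ d] (mod p)" "[d' * h ^ c' = c' * h ^ d'] (mod p)"
    define k where "k = c - d"
    have k: "c = d + k" "c' = d' + k" using less eq by (auto simp: k_def)
    have k0: "0 < k" "k < p" using less D(2)[OF D'(1)] by (auto simp: k_def)
    have 1: "int p dvd int d * (int h ^ k - 1) - int k" "int p dvd int d' * (int h ^ k - 1) - int k"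
      using key cd unfolding k by blast+
    \<comment> \<open>If h^k were 1 modulo p, the relation would force p to divide k, although 0 < k
      < p.\<close>
    have ndvd: "\<not> int p dvd int h ^ k - 1"
    proof
      assume "int p dvd int h ^ k - 1"
      then have "int p dvd int d * (int h ^ k - 1)" by simp
      with 1 have "int p dvd int k" by (metis dvd_diff_right_iff)
      then show False using k0 by (auto dest: dvd_imp_le)
    qed
    have "int p dvd (int d - int d') * (int h ^ k - 1)"
      using dvd_diff[OF 1] by (simp add: algebra_simps)
    with ndvd have "int p dvd int d - int d'"
      using p prime_dvd_multD[of "int p"] by auto
    then have "[d = d'] (mod p)" by (metis cong_iff_dvd_diff cong_int_iff)
    then have "d = d'" using D' D(2) by (simp add: cong_def)
    then show "c = c'" "d = d'" using k by auto
  qed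
  \<comment> \<open>Two members of a dyadic range differ by less than \<Delta>, so only \<Delta>
    differences can occur.\<close>
  moreover have "(\<lambda>(c, d). c - d) ` ?A \<subseteq> {..<\<Delta>}"
  proof clarsimp
    fix c d assume "c \<in> D" "d \<in> D" "d < c"
    then have "\<Delta> \<le> d" "c < 2 * \<Delta>" using D(1) by auto
    then show "c - d < \<Delta>" using \<open>d < c\<close> by linarith
  qed
  ultimately show ?thesis
    using card_inj_on_le[of "\<lambda>(c, d). c - d" ?A "{..<\<Delta>}"] by simp
qed

text \<open>The relation is symmetric: pairs with d < c, their mirror images and the diagonal give
  at most \<Delta> each.\<close>

lemma card_coincidences_le_triple:
  fixes p h \<Delta> :: nat
  assumes p: "prime p" and h: "coprime h p" and D: "D \<subseteq> {\<Delta>..<2 * \<Delta>}" "\<And>d. d \<in> D \<Longrightarrow> d < p"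
  shows "card {(c, d) \<in> D \<times> D. [d * h ^ c = c * h ^ d] (mod p)} \<le> 3 * \<Delta>"
proof -
  let ?A = "{(c, d) \<in> D \<times> D. d < c \<and> [d * h ^ c = c * h ^ d] (mod p)}"
  have fD: "finite D" using D(1) finite_subset by blast
  have fA: "finite ?A" by (rule finite_subset[of _ "D \<times> D"]) (use fD in auto)
  have "{(c, d) \<in> D \<times> D. [d * h ^ c = c * h ^ d] (mod p)} \<subseteq> ?A \<union> (prod.swap ` ?A \<union> (\<lambda>d. (d, d)) ` D)"
  proof safe
    fix c d assume cd: "c \<in> D" "d \<in> D" "[d * h ^ c = c * h ^ d] (mod p)"
      "(c, d) \<notin> (\<lambda>d. (d, d)) ` D" "(c, d) \<notin> prod.swap ` ?A"
    then have "c \<noteq> d" by auto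
    moreover have "\<not> c < d"
    proof
      assume "c < d"
      then have "(d, c) \<in> ?A" using cd by (auto intro: cong_sym)
      then have "(c, d) \<in> prod.swap ` ?A" by force
      then show False using cd by blast
    qed
    ultimately show "d < c" by simp
  qed
  then have "card {(c, d) \<in> D \<times> D. [d * h ^ c = c * h ^ d] (mod p)} \<le> card (?A \<union> (prod.swap ` ?A \<union> (\<lambda>d. (d, d)) ` D))"
    using fA fD by (intro card_mono) auto
  also have "\<dots> \<le> card ?A + (card (prod.swap ` ?A) + card ((\<lambda>d. (d, d)) ` D))"
    by (meson add_left_mono card_Un_le le_trans)
  also have "\<dots> \<le> card ?A + (card ?A + card D)"
    using fA fD by (intro add_mono card_image_le) auto
  also have "card D \<le> \<Delta>" using card_mono[OF _ D(1)] by simp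
  also have "card ?A \<le> \<Delta>" by (rule card_diff_coincidences_le[OF assms])
  finally show ?thesis by simp
qed

text \<open>Fix u. There are at most N/\<Delta> values v and, by the coincidence bound for h = g^u,
  at most 3 \<Delta> pairs sharing one, so Cauchy gives at most sqrt(3 N) pairs (d, v). Then sum
  over the K/\<Delta> possible u.\<close>

lemma card_dyadic_points_le_sqrt:
  assumes p: "prime p" and g: "coprime p g" and a: "coprime a p" and K: "K < p" and N: "N < p" and \<Delta>: "\<Delta> > 0"
  shows "real (card (dyadic_points p a g K N \<Delta>)) \<le> real (K div \<Delta>) * sqrt (3 * real N)"
proof -
  define L where "L = K div \<Delta>"
  define S where "S u = {(d, v). (d, u, v) \<in> dyadic_points p a g K N \<Delta>}" for u
  have finS: "finite (S u)" for u
    by (rule finite_subset[of _ "(\<lambda>(d, u, v). (d, v)) ` dyadic_points p a g K N \<Delta>"])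
      (auto simp: S_def image_def intro!: bexI)
  have cardS: "real (card (S u)) \<le> sqrt (3 * real N)" for u
  proof -
    define h where "h = g ^ u"
    define D where "D = fst ` S u"
    have hp: "coprime h p" using g by (simp add: h_def coprime_commute)
    have SD: "\<Delta> \<le> d" "d < 2 * \<Delta>" "d < p" "0 < d" "1 \<le> v" "v \<le> N div \<Delta>" "v < p" "[d * v = a * h ^ d] (mod p)"
      if "(d, v) \<in> S u" for d v
    proof -
      from that have *: "(d, u, v) \<in> dyadic_points p a g K N \<Delta>" by (simp add: S_def)
      note 1 = dyadic_pointsD[OF * \<Delta>]
      show "\<Delta> \<le> d" "d < 2 * \<Delta>" "d < p" "0 < d" "1 \<le> v" "v \<le> N div \<Delta>"
        using 1 K \<Delta> by linarith+
      show "v < p" using 1 N by (meson div_le_dividend le_less_trans)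
      show "[d * v = a * h ^ d] (mod p)"
        using 1 by (simp add: h_def power_mult[symmetric] mult.commute)
    qed
    let ?P = "{(x, y) \<in> S u \<times> S u. snd x = snd y}"
    let ?Q = "{(c, d) \<in> D \<times> D. [d * h ^ c = c * h ^ d] (mod p)}"
    \<comment> \<open>Forgetting v loses nothing: d and u determine v modulo p, and v < p. The
      relation in \<open>?Q\<close> comes from multiplying the two curve congruences crosswise and
      cancelling a v.\<close>
    have "card ?P \<le> card ?Q"
    proof (rule card_inj_on_le)
      show "inj_on (\<lambda>(x, y). (fst x, fst y)) ?P"
      proof (rule inj_onI, clarsimp)
        fix c v d v' assume *: "(c, v) \<in> S u" "(c, v') \<in> S u"
        then have "[c * v = c * v'] (mod p)" by (meson SD(8) cong_sym cong_trans)
        then have "[v = v'] (mod p)"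
          using cong_mult_lcancel_nat coprime_less_prime[OF p SD(4)[OF *(1)] SD(3)[OF *(1)]] by blast
        then show "v = v'" using SD(7)[OF *(1)] SD(7)[OF *(2)] by (simp add: cong_def)
      qed
      show "(\<lambda>(x, y). (fst x, fst y)) ` ?P \<subseteq> ?Q"
      proof (clarsimp, intro conjI)
        fix c v d assume *: "(c, v) \<in> S u" "(d, v) \<in> S u"
        show "c \<in> D" "d \<in> D" using * by (force simp: D_def)+
        have "[(c * v) * (a * h ^ d) = (a * h ^ c) * (d * v)] (mod p)"
          by (intro cong_mult SD(8) cong_sym[OF SD(8)] *)
        then have "[(c * h ^ d) * (a * v) = (d * h ^ c) * (a * v)] (mod p)"
          by (simp add: mult_ac)
        moreover have "coprime (a * v) p"
          using a coprime_less_prime[OF p _ SD(7)[OF *(1)]] SD(5)[OF *(1)] by simp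
        ultimately show "[d * h ^ c = c * h ^ d] (mod p)"
          using cong_mult_rcancel_nat cong_sym by blast
      qed
      show "finite ?Q"
        by (rule finite_subset[of _ "D \<times> D"]) (auto simp: D_def finS)
    qed
    also have "card ?Q \<le> 3 * \<Delta>"
      by (rule card_coincidences_le_triple[OF p hp]) (auto simp: D_def dest: SD)
    finally have PQ: "card ?P \<le> 3 * \<Delta>" .
    have "(real (card (S u)))\<^sup>2 \<le> real (card {1..N div \<Delta>}) * real (card ?P)"
      by (rule card_power2_le_coincidences[OF finS]) (use SD(5,6) in \<open>auto simp: Suc_le_eq\<close>)
    also have "\<dots> \<le> real (N div \<Delta>) * (3 * real \<Delta>)"
      using PQ by (intro mult_mono) auto
    also have "\<dots> = 3 * real (N div \<Delta> * \<Delta>)" by simp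
    also have "\<dots> \<le> 3 * real N" by (intro mult_left_mono of_nat_mono) auto
    finally show ?thesis by (rule real_le_rsqrt)
  qed
  have "dyadic_points p a g K N \<Delta> \<subseteq> (\<Union>u\<in>{1..L}. (\<lambda>(d, v). (d, u, v)) ` S u)"
  proof
    fix x assume x: "x \<in> dyadic_points p a g K N \<Delta>"
    obtain d u v where [simp]: "x = (d, u, v)" by (cases x)
    have "u \<in> {1..L}" using dyadic_pointsD[of d u v] x \<Delta> by (auto simp: L_def)
    moreover have "(d, v) \<in> S u" using x by (simp add: S_def)
    ultimately show "x \<in> (\<Union>u\<in>{1..L}. (\<lambda>(d, v). (d, u, v)) ` S u)" by force
  qed
  then have "card (dyadic_points p a g K N \<Delta>) \<le> card (\<Union>u\<in>{1..L}. (\<lambda>(d, v). (d, u, v)) ` S u)"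
    by (intro card_mono finite_UN_I finite_imageI finS) auto
  also have "\<dots> \<le> (\<Sum>u\<in>{1..L}. card ((\<lambda>(d, v). (d, u, v)) ` S u))"
    by (intro card_UN_le) auto
  also have "\<dots> \<le> (\<Sum>u\<in>{1..L}. card (S u))"
    by (intro sum_mono card_image_le finS)
  finally have "real (card (dyadic_points p a g K N \<Delta>)) \<le> (\<Sum>u\<in>{1..L}. real (card (S u)))"
    by (metis of_nat_mono of_nat_sum)
  also have "\<dots> \<le> (\<Sum>u\<in>{1..L}. sqrt (3 * real N))" by (intro sum_mono cardS)
  also have "\<dots> = real L * sqrt (3 * real N)" by simp
  finally show ?thesis by (simp add: L_def)
qed

text \<open>In \<open>R\<close> the exponent u is replaced by i - j, with g^(d j) moved to the left
  so that no negative power occurs. Cauchy over v leads to a congruence in four exponents for each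
  pair (c, d). Discarding its coefficients leaves a linear congruence modulo the order of g, and the
  gcds that arise are averaged over c and d.\<close>

lemma card_shifted_points_le:
  fixes p a g K N \<Delta> :: nat
  assumes p: "prime p" and g: "coprime p g" and a: "coprime a p" and K: "K \<le> ord p g" "K < p" and N: "N < p"
    and \<Delta>: "\<Delta> > 0" "\<Delta> \<le> K"
  defines "L \<equiv> K div \<Delta>"
  defines "R \<equiv> {(d, i, j, v) \<in> {\<Delta>..<2 * \<Delta>} \<times> {1..2 * L} \<times> {1..2 * L} \<times> {1..N div \<Delta>}.
      d \<le> K \<and> [d * v * g ^ (d * j) = a * g ^ (d * i)] (mod p)}"
  shows "(real (card R))\<^sup>2 \<le> real (N div \<Delta>) * (32 * (real L)\<^sup>2 * ((real \<Delta>)\<^sup>2 + 8 * real L * real \<Delta> * harm (2 * \<Delta>)))"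
proof -
  define t where "t = ord p g"
  define D where "D = {d\<in>{\<Delta>..<2 * \<Delta>}. d \<le> K}"
  define B where "B = {1..2 * L} \<times> {1..2 * L}"
  define \<phi> where "\<phi> c d z = g ^ (c * fst z + d * snd z)" for c d :: nat and z :: "nat \<times> nat"
  define C where "C c d = {(x, y) \<in> B \<times> B. d * \<phi> c d x mod p = c * \<phi> c d y mod p}" for c d
  have L: "L > 0" "L * \<Delta> \<le> K" using \<Delta> by (auto simp: L_def div_greater_zero_iff)
  have t: "t > 0" using g by (simp add: t_def)
  have finB: "finite B" by (simp add: B_def)
  have finC: "finite (C c d)" for c d
    by (rule finite_subset[of _ "B \<times> B"]) (auto simp: C_def finB)
  have finR: "finite R"
    by (rule finite_subset[of _ "{\<Delta>..<2 * \<Delta>} \<times> {1..2 * L} \<times> {1..2 * L} \<times> {1..N div \<Delta>}"]) (auto simp: R_def)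
  have Dp: "coprime d p" "0 < d" if "d \<in> D" for d
    using that \<Delta> K p by (auto simp: D_def intro!: coprime_less_prime)
  have cardC: "real (card (C c d)) \<le> 32 * (real L)\<^sup>2 * (1 + 2 * real L / real \<Delta> * real (gcd c d))"
    if c: "c \<in> D" and d: "d \<in> D" for c d
  proof -
    \<comment> \<open>The coefficients d and c disappear here: multiplication by either is injective
      modulo p, as the twisted coincidence bound requires.\<close>
    have "card (C c d) \<le> card {(x, y) \<in> B \<times> B. \<phi> c d x mod p = \<phi> c d y mod p}"
      unfolding C_def using finB
    proof (rule card_twisted_coincidences_le)
      show "\<phi> c d x mod p = \<phi> c d y mod p" if "d * \<phi> c d x mod p = d * \<phi> c d y mod p" for x y
        using that cong_mult_lcancel_nat[OF Dp(1)[OF d]] by (simp add: cong_def)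
      show "\<phi> c d x mod p = \<phi> c d y mod p" if "c * \<phi> c d x mod p = c * \<phi> c d y mod p" for x y
        using that cong_mult_lcancel_nat[OF Dp(1)[OF c]] by (simp add: cong_def)
    qed
    also have "{(x, y) \<in> B \<times> B. \<phi> c d x mod p = \<phi> c d y mod p}
        = prod.swap ` (SIGMA y:B. {x\<in>B. [c * fst x + d * snd x = c * fst y + d * snd y] (mod t)})"
      using order_divides_expdiff[OF g] by (force simp: \<phi>_def t_def cong_def[of "g ^ _"])
    also have "card \<dots> = card (SIGMA y:B. {x\<in>B. [c * fst x + d * snd x = c * fst y + d * snd y] (mod t)})"
      by (intro card_image) (auto simp: inj_on_def)
    also have "\<dots> = (\<Sum>y\<in>B. card {x\<in>B. [c * fst x + d * snd x = c * fst y + d * snd y] (mod t)})"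
      using finB by simp
    also have "\<dots> \<le> (\<Sum>y\<in>B. 8 * (2 * L div (d div gcd c d) + 1))"
    proof (intro sum_mono)
      fix y
      \<comment> \<open>Source of the 8: c and d are below 2 \<Delta>, and L \<Delta> is at most K,
        hence at most the order t.\<close>
      have "(c + d) * (2 * L) < (4 * \<Delta>) * (2 * L)"
        using c d L by (intro mult_strict_right_mono) (auto simp: D_def)
      also have "\<dots> = 8 * (L * \<Delta>)" by simp
      also have "\<dots> \<le> 8 * t" using L K by (simp add: t_def)
      finally have "card {(i, j) \<in> {1..2 * L} \<times> {1..2 * L}. [c * i + d * j = c * fst y + d * snd y] (mod t)}
          \<le> 8 * (2 * L div (d div gcd c d) + 1)"
        using Dp(2)[OF d] t by (intro card_cong_line_points_le)
      moreover have "{x\<in>B. [c * fst x + d * snd x = c * fst y + d * snd y] (mod t)}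
          = {(i, j) \<in> {1..2 * L} \<times> {1..2 * L}. [c * i + d * j = c * fst y + d * snd y] (mod t)}"
        unfolding B_def by auto
      ultimately show "card {x\<in>B. [c * fst x + d * snd x = c * fst y + d * snd y] (mod t)} \<le> 8 * (2 * L div (d div gcd c d) + 1)"
        by (simp only:)
    qed
    also have "\<dots> = 32 * L\<^sup>2 * (1 + 2 * L div (d div gcd c d))"
      by (simp add: B_def card_cartesian_product power2_eq_square algebra_simps)
    finally have "real (card (C c d)) \<le> 32 * (real L)\<^sup>2 * (1 + real (2 * L div (d div gcd c d)))"
      by (metis (mono_tags, lifting) of_nat_1 of_nat_add of_nat_mono of_nat_mult of_nat_numeral of_nat_power)
    also have "\<dots> \<le> 32 * (real L)\<^sup>2 * (1 + 2 * real L / real \<Delta> * real (gcd c d))"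
    proof (intro mult_left_mono add_left_mono)
      have "real (2 * L div (d div gcd c d)) \<le> real (2 * L) / real (d div gcd c d)"
        by (rule of_nat_div_le_of_nat)
      also have "real (d div gcd c d) = real d / real (gcd c d)"
        by (simp add: real_of_nat_div)
      also have "real (2 * L) / (real d / real (gcd c d)) = 2 * real L * real (gcd c d) / real d"
        by simp
      also have "\<dots> \<le> 2 * real L * real (gcd c d) / real \<Delta>"
        using d \<Delta> by (intro divide_left_mono) (auto simp: D_def)
      finally show "real (2 * L div (d div gcd c d)) \<le> 2 * real L / real \<Delta> * real (gcd c d)" by simp
    qed auto
    finally show ?thesis .
  qed
  let ?v = "\<lambda>(d, i, j, v). v :: nat"
  let ?P = "{(x, y) \<in> R \<times> R. ?v x = ?v y}"
  let ?Q = "SIGMA cd:D \<times> D. C (fst cd) (snd cd)"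
  \<comment> \<open>The exponents are regrouped as (i, j') and (j, i'), so that both sides of the
    congruence are values of the same function \<open>\<phi> c d\<close>. The dropped v is
    determined modulo p by c, i and j.\<close>
  let ?\<Psi> = "\<lambda>((c, i, j, v :: nat), (d, i', j', v' :: nat)). ((c, d), ((i, j'), (j, i')))"
  have finD: "finite D" by (simp add: D_def)
  have "card ?P \<le> card ?Q"
  proof (rule card_inj_on_le)
    show "inj_on ?\<Psi> ?P"
    proof (rule inj_onI, clarsimp)
      fix c i j v d i' j' w
      assume *: "(c, i, j, v) \<in> R" "(c, i, j, w) \<in> R"
      then have "[c * g ^ (c * j) * v = c * g ^ (c * j) * w] (mod p)"
        by (auto simp: R_def mult_ac intro: cong_trans cong_sym)
      moreover have "coprime (c * g ^ (c * j)) p"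
        using * g Dp(1)[of c] by (auto simp: R_def D_def coprime_commute)
      ultimately have "[v = w] (mod p)" using cong_mult_lcancel_nat by blast
      moreover have "v < p" "w < p"
        using * N by (auto simp: R_def intro: le_less_trans div_le_dividend)
      ultimately show "v = w" by (simp add: cong_def)
    qed
    show "?\<Psi> ` ?P \<subseteq> ?Q"
    proof (clarsimp, intro conjI)
      fix c i j v d i' j'
      assume *: "(c, i, j, v) \<in> R" "(d, i', j', v) \<in> R"
      show "c \<in> D" "d \<in> D" using * by (auto simp: R_def D_def)
      have v: "0 < v" "v < p"
        using * N by (auto simp: R_def intro: le_less_trans div_le_dividend)
      have "[(c * v * g ^ (c * j)) * (a * g ^ (d * i')) = (a * g ^ (c * i)) * (d * v * g ^ (d * j'))] (mod p)"
        by (rule cong_mult[OF _ cong_sym]) (use * in \<open>simp_all add: R_def\<close>)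
      then have "[(d * g ^ (c * i + d * j')) * (a * v) = (c * g ^ (c * j + d * i')) * (a * v)] (mod p)"
        using cong_sym by (simp add: power_add mult_ac)
      moreover have "coprime (a * v) p"
        using a coprime_less_prime[OF p v] by simp
      ultimately have "[d * g ^ (c * i + d * j') = c * g ^ (c * j + d * i')] (mod p)"
        using cong_mult_rcancel_nat by blast
      then show "((i, j'), j, i') \<in> C c d"
        using * by (auto simp: C_def B_def R_def \<phi>_def cong_def)
    qed
    show "finite ?Q" using finD finC by (intro finite_SigmaI) auto
  qed
  also have "card ?Q = (\<Sum>c\<in>D. \<Sum>d\<in>D. card (C c d))"
    using finD finC by (simp add: sum.cartesian_product case_prod_beta')
  finally have "real (card ?P) \<le> (\<Sum>c\<in>D. \<Sum>d\<in>D. real (card (C c d)))"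
    by (metis (mono_tags, lifting) of_nat_mono of_nat_sum sum.cong)
  also have "\<dots> \<le> (\<Sum>c\<in>D. \<Sum>d\<in>D. 32 * (real L)\<^sup>2 * (1 + 2 * real L / real \<Delta> * real (gcd c d)))"
    by (intro sum_mono cardC)
  also have "\<dots> = 32 * (real L)\<^sup>2 * ((real (card D))\<^sup>2 + 2 * real L / real \<Delta> * (\<Sum>c\<in>D. \<Sum>d\<in>D. real (gcd c d)))"
    by (simp add: sum_distrib_left[symmetric] sum_divide_distrib[symmetric] sum.distrib distrib_left power2_eq_square)
  \<comment> \<open>The gcd sum is extended to {1..2 \<Delta>}, whence the factor 4.\<close>
  also have "\<dots> \<le> 32 * (real L)\<^sup>2 * ((real \<Delta>)\<^sup>2 + 2 * real L / real \<Delta> * (4 * (real \<Delta>)\<^sup>2 * harm (2 * \<Delta>)))"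
  proof (intro mult_left_mono add_mono power_mono)
    have "card D \<le> card {\<Delta>..<2 * \<Delta>}" by (intro card_mono) (auto simp: D_def)
    then show "real (card D) \<le> real \<Delta>" by simp
    have sub: "D \<subseteq> {1..2 * \<Delta>}" using \<Delta> by (auto simp: D_def)
    have "(\<Sum>c\<in>D. \<Sum>d\<in>D. real (gcd c d)) \<le> (\<Sum>c\<in>D. \<Sum>d\<in>{1..2 * \<Delta>}. real (gcd c d))"
      using sub by (intro sum_mono sum_mono2) auto
    also have "\<dots> \<le> (\<Sum>c\<in>{1..2 * \<Delta>}. \<Sum>d\<in>{1..2 * \<Delta>}. real (gcd c d))"
      using sub by (intro sum_mono2) (auto intro: sum_nonneg)
    also have "\<dots> \<le> (real (2 * \<Delta>))\<^sup>2 * harm (2 * \<Delta>)" by (rule sum_gcd_le)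
    finally show "(\<Sum>c\<in>D. \<Sum>d\<in>D. real (gcd c d)) \<le> 4 * (real \<Delta>)\<^sup>2 * harm (2 * \<Delta>)"
      by (simp add: power2_eq_square)
  qed auto
  also have "\<dots> = 32 * (real L)\<^sup>2 * ((real \<Delta>)\<^sup>2 + 8 * real L * real \<Delta> * harm (2 * \<Delta>))"
    using \<Delta> by (simp add: power2_eq_square field_simps)
  finally have P: "real (card ?P) \<le> 32 * (real L)\<^sup>2 * ((real \<Delta>)\<^sup>2 + 8 * real L * real \<Delta> * harm (2 * \<Delta>))" .
  have "(real (card R))\<^sup>2 \<le> real (card {1..N div \<Delta>}) * real (card ?P)"
    by (rule card_power2_le_coincidences[OF finR]) (auto simp: R_def)
  also have "\<dots> \<le> real (N div \<Delta>) * (32 * (real L)\<^sup>2 * ((real \<Delta>)\<^sup>2 + 8 * real L * real \<Delta> * harm (2 * \<Delta>)))"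
    using P by (intro mult_mono) auto
  finally show ?thesis .
qed

text \<open>Each point (d, u, v) produces L shifted points (d, j + u, j, v), one for every j up to
  L; since also u is at most L, the exponents stay within 2 L. The map is injective because u = i -
  j, so |W| L is at most |R|, and the factor L^2 cancels after squaring.\<close>

lemma card_dyadic_points_power2_le:
  assumes p: "prime p" and g: "coprime p g" and a: "coprime a p" and K: "K \<le> ord p g" "K < p" and N: "N < p"
    and \<Delta>: "\<Delta> > 0"
  shows "(real (card (dyadic_points p a g K N \<Delta>)))\<^sup>2
    \<le> 32 * (real N / real \<Delta>) * ((real \<Delta>)\<^sup>2 + 8 * real K * harm (2 * \<Delta>))"
proof (cases "\<Delta> \<le> K")
  case False
  have "dyadic_points p a g K N \<Delta> = {}"
    using dyadic_pointsD[OF _ \<Delta>] False by fastforce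
  then show ?thesis by (simp add: harm_nonneg)
next
  case True
  define L where "L = K div \<Delta>"
  define W where "W = dyadic_points p a g K N \<Delta>"
  define R where "R = {(d, i, j, v) \<in> {\<Delta>..<2 * \<Delta>} \<times> {1..2 * L} \<times> {1..2 * L} \<times> {1..N div \<Delta>}.
      d \<le> K \<and> [d * v * g ^ (d * j) = a * g ^ (d * i)] (mod p)}"
  have L: "L > 0" "L * \<Delta> \<le> K" using \<Delta> True by (auto simp: L_def div_greater_zero_iff)
  have "card (W \<times> {1..L}) \<le> card R"
  proof (rule card_inj_on_le)
    show "inj_on (\<lambda>((d, u, v), j). (d, j + u, j, v)) (W \<times> {1..L})"
      by (auto simp: inj_on_def)
    show "(\<lambda>((d, u, v), j). (d, j + u, j, v)) ` (W \<times> {1..L}) \<subseteq> R"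
    proof clarsimp
      fix d u v j assume w: "(d, u, v) \<in> W" and j: "Suc 0 \<le> j" "j \<le> L"
      note * = dyadic_pointsD[OF w[unfolded W_def] \<Delta>]
      have "[d * v * g ^ (d * j) = a * g ^ (d * u) * g ^ (d * j)] (mod p)"
        using *(10) by (rule cong_scalar_right)
      then have "[d * v * g ^ (d * j) = a * g ^ (d * (j + u))] (mod p)"
        by (simp add: power_add distrib_left mult_ac)
      with * j show "(d, j + u, j, v) \<in> R"
        by (auto simp: R_def L_def)
    qed
    show "finite R"
      by (rule finite_subset[of _ "{\<Delta>..<2 * \<Delta>} \<times> {1..2 * L} \<times> {1..2 * L} \<times> {1..N div \<Delta>}"]) (auto simp: R_def)
  qed
  then have "real (card W * L) \<le> real (card R)"
    by (simp only: card_cartesian_product card_atLeastAtMost diff_Suc_1 of_nat_mono)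
  then have "(real (card W) * real L)\<^sup>2 \<le> (real (card R))\<^sup>2"
    by (intro power_mono) auto
  also have "\<dots> \<le> real (N div \<Delta>) * (32 * (real L)\<^sup>2 * ((real \<Delta>)\<^sup>2 + 8 * real L * real \<Delta> * harm (2 * \<Delta>)))"
    unfolding R_def L_def by (rule card_shifted_points_le[OF p g a K N \<Delta> True])
  finally have "(real L)\<^sup>2 * (real (card W))\<^sup>2 \<le> (real L)\<^sup>2 * (32 * real (N div \<Delta>) * ((real \<Delta>)\<^sup>2 + 8 * real (L * \<Delta>) * harm (2 * \<Delta>)))"
    by (simp add: power_mult_distrib mult_ac)
  then have "(real (card W))\<^sup>2 \<le> 32 * real (N div \<Delta>) * ((real \<Delta>)\<^sup>2 + 8 * real (L * \<Delta>) * harm (2 * \<Delta>))"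
    using L by (simp only: mult_le_cancel_left_pos zero_less_power of_nat_0_less_iff)
  also have "\<dots> \<le> 32 * (real N / real \<Delta>) * ((real \<Delta>)\<^sup>2 + 8 * real K * harm (2 * \<Delta>))"
    using L by (intro mult_mono add_mono mult_left_mono mult_right_mono of_nat_div_le_of_nat)
      (auto simp: harm_nonneg simp flip: of_nat_mult intro!: add_nonneg_nonneg mult_nonneg_nonneg)
  finally show ?thesis by (simp add: W_def)
qed

section \<open>The Moebius function\<close>

text \<open>Real-valued so that it can weight sums directly. On squarefree arguments counting
  distinct primes counts all prime factors.\<close>

definition moebius_mu :: "nat \<Rightarrow> real" where
  "moebius_mu n = (if squarefree n then (-1) ^ card (prime_factors n) else 0)"

lemma abs_moebius_le: "\<bar>moebius_mu n\<bar> \<le> 1"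
  by (simp add: moebius_mu_def)

lemma moebius_mu_1 [simp]: "moebius_mu (Suc 0) = 1"
  by (simp add: moebius_mu_def)

text \<open>For a prime \<open>q\<close> dividing \<open>n\<close>, the squarefree divisors of \<open>n\<close> pair off as \<open>d \<leftrightarrow> q d\<close>.\<close>

lemma sum_moebius_divisors:
  assumes "n > 1"
  shows "(\<Sum>d | d dvd n. moebius_mu d) = 0"
proof -
  obtain q where q: "prime q" "q dvd n"
    using assms by (metis nat_neq_iff prime_factor_nat)
  define A where "A = {d. d dvd n \<and> squarefree d \<and> \<not> q dvd d}"
  define B where "B = {d. d dvd n \<and> squarefree d \<and> q dvd d}"
  have fin: "finite {d. d dvd n}" using assms by simp
  have finAB: "finite A" "finite B" "A \<inter> B = {}"
    using fin by (auto simp: A_def B_def intro: finite_subset[OF _ fin])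
  have "(\<Sum>d | d dvd n. moebius_mu d) = (\<Sum>d\<in>A \<union> B. moebius_mu d)"
    using fin by (intro sum.mono_neutral_right) (auto simp: A_def B_def moebius_mu_def)
  also have "\<dots> = (\<Sum>d\<in>A. moebius_mu d) + (\<Sum>d\<in>B. moebius_mu d)"
    using finAB by (intro sum.union_disjoint)
  also have "(\<Sum>d\<in>B. moebius_mu d) = (\<Sum>d\<in>A. - moebius_mu d)"
  proof (rule sum.reindex_bij_witness[of _ "\<lambda>d. q * d" "\<lambda>d. d div q"])
    fix d assume "d \<in> A"
    then have d: "d dvd n" "squarefree d" "coprime q d" "d > 0"
      using q assms by (auto simp: A_def prime_imp_coprime_nat intro!: Nat.gr0I)
    then have *: "q * d dvd n" "squarefree (q * d)"
      using q by (auto simp: divides_mult squarefree_mult_coprime squarefree_prime)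
    show "q * d div q = d" "q * d \<in> B"
      using * q by (auto simp: B_def prime_gt_0_nat)
  next
    fix d assume "d \<in> B"
    then obtain e where e: "d = q * e" and d: "d dvd n" "squarefree d"
      by (auto simp: B_def)
    have "\<not> q dvd e"
    proof
      assume "q dvd e"
      then have "q ^ 2 dvd d" by (auto simp: e power2_eq_square)
      then show False using d q by (metis not_prime_unit squarefree_def)
    qed
    have q0: "q > 0" using q by (simp add: prime_gt_0_nat)
    have "e > 0" using d assms e by (auto intro!: Nat.gr0I)
    have eA: "e \<in> A"
      using d e \<open>\<not> q dvd e\<close> by (auto simp: A_def dest: dvd_mult_right squarefree_multD)
    then show "q * (d div q) = d" "d div q \<in> A" using e q0 by auto
    have "prime_factors d = insert q (prime_factors e)"
      using e q \<open>e > 0\<close> q0 by (simp add: prime_factors_product prime_prime_factors)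
    moreover have "q \<notin> prime_factors e" using \<open>\<not> q dvd e\<close> by auto
    ultimately have "card (prime_factors d) = Suc (card (prime_factors e))" by simp
    then show "- moebius_mu (d div q) = moebius_mu d"
      using eA d e q0 by (simp add: moebius_mu_def A_def)
  qed
  finally show ?thesis by (simp add: sum_negf)
qed

text \<open>The divisors are drawn from a fixed range {1..X}, so that one range serves all n up to X
  and sums can be interchanged.\<close>

lemma sum_moebius_dvd:
  assumes "n > 0" "n \<le> X"
  shows "(\<Sum>d\<in>{1..X}. if d dvd n then moebius_mu d else 0) = (if n = 1 then 1 else 0)"
proof -
  have "(\<Sum>d\<in>{1..X}. if d dvd n then moebius_mu d else 0) = (\<Sum>d\<in>{d\<in>{1..X}. d dvd n}. moebius_mu d)"
    by (rule sum.inter_filter[symmetric]) simp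
  also have "{d\<in>{1..X}. d dvd n} = {d. d dvd n}"
    using assms dvd_imp_le[of _ n] by (force simp: Suc_le_eq dvd_pos_nat)
  also have "(\<Sum>d | d dvd n. moebius_mu d) = (if n = 1 then 1 else 0)"
    using sum_moebius_divisors[of n] assms by auto
  finally show ?thesis .
qed

text \<open>Coprimality is expressed as the Moebius sum over divisors of the gcd, which is at most x
  and hence at most X; then the sums are swapped.\<close>

lemma card_coprime_eq_sum_moebius:
  fixes S :: "(nat \<times> nat) set"
  assumes S: "finite S" "\<And>x y. (x, y) \<in> S \<Longrightarrow> 0 < x \<and> x \<le> X"
  shows "real (card {(x, y) \<in> S. coprime x y})
    = (\<Sum>d\<in>{1..X}. moebius_mu d * real (card {(x, y) \<in> S. d dvd x \<and> d dvd y}))"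
proof -
  have "real (card {(x, y) \<in> S. coprime x y}) = (\<Sum>z\<in>S. if coprime (fst z) (snd z) then 1 else 0)"
    using S(1) by (simp add: sum.If_cases Int_def case_prod_beta')
  also have "\<dots> = (\<Sum>z\<in>S. \<Sum>d\<in>{1..X}. if d dvd gcd (fst z) (snd z) then moebius_mu d else 0)"
  proof (intro sum.cong refl)
    fix z assume "z \<in> S"
    then have "0 < fst z" "fst z \<le> X" using S(2)[of "fst z" "snd z"] by auto
    moreover from this have "gcd (fst z) (snd z) \<le> fst z"
      by (intro gcd_le1_nat) simp
    ultimately have *: "0 < gcd (fst z) (snd z)" "gcd (fst z) (snd z) \<le> X"
      by (simp, linarith)
    show "(if coprime (fst z) (snd z) then 1 else 0)
        = (\<Sum>d\<in>{1..X}. if d dvd gcd (fst z) (snd z) then moebius_mu d else 0)"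
      unfolding sum_moebius_dvd[OF *] coprime_iff_gcd_eq_1 ..
  qed
  also have "\<dots> = (\<Sum>d\<in>{1..X}. \<Sum>z\<in>S. if d dvd gcd (fst z) (snd z) then moebius_mu d else 0)"
    by (rule sum.swap)
  also have "\<dots> = (\<Sum>d\<in>{1..X}. moebius_mu d * real (card {(x, y) \<in> S. d dvd x \<and> d dvd y}))"
    using S(1) by (intro sum.cong refl) (simp add: sum.If_cases Int_def case_prod_beta' mult.commute)
  finally show ?thesis .
qed

text \<open>The upper estimate holds because the partial sum plus 1/n decreases in n, by 1/(x+1)^2
  <= 1/x - 1/(x+1), and tends to zeta(2).\<close>

lemma zeta2_partial_sum_bounds:
  assumes "n > 0"
  shows "(\<Sum>m\<in>{1..n}. 1 / (real m)\<^sup>2) \<le> pi\<^sup>2 / 6" "pi\<^sup>2 / 6 \<le> (\<Sum>m\<in>{1..n}. 1 / (real m)\<^sup>2) + 1 / real n"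
proof -
  define f where "f k = 1 / (real k + 1)\<^sup>2" for k
  have f: "f sums (pi\<^sup>2 / 6)"
    using inverse_squares_sums by (simp add: f_def [abs_def] add.commute)
  have eq: "(\<Sum>m\<in>{1..n}. 1 / (real m)\<^sup>2) = sum f {..<n}" for n
    by (simp add: f_def sum.atLeast1_atMost_eq add.commute)
  show "(\<Sum>m\<in>{1..n}. 1 / (real m)\<^sup>2) \<le> pi\<^sup>2 / 6"
    unfolding eq using sum_le_suminf[of f "{..<n}"] f by (auto simp: sums_iff f_def)
  have step: "sum f {..<n + k} + 1 / real (n + k) \<le> sum f {..<n} + 1 / real n" for k
  proof (induction k)
    case (Suc k)
    define x where "x = real (n + k)"
    have x: "x > 0" using assms by (simp add: x_def)
    have "1 / (x + 1)\<^sup>2 \<le> 1 / x - 1 / (x + 1)"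
    proof -
      have "1 / x - 1 / (x + 1) = 1 / (x * (x + 1))" using x by (simp add: field_simps)
      also have "\<dots> \<ge> 1 / (x + 1)\<^sup>2"
        using x by (intro divide_left_mono) (auto simp: power2_eq_square)
      finally show ?thesis .
    qed
    then have "sum f {..<n + Suc k} + 1 / real (n + Suc k) \<le> sum f {..<n + k} + 1 / real (n + k)"
      by (simp add: f_def x_def algebra_simps)
    with Suc show ?case by linarith
  qed simp
  have "(\<lambda>k. sum f {..<n + k}) \<longlonglongrightarrow> pi\<^sup>2 / 6"
    using f unfolding sums_def by (subst add.commute) (rule LIMSEQ_ignore_initial_segment)
  moreover have "sum f {..<n + k} \<le> sum f {..<n} + 1 / real n" for k
    using step[of k] assms by (smt (verit) divide_nonneg_nonneg of_nat_0_le_iff)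
  ultimately have "pi\<^sup>2 / 6 \<le> sum f {..<n} + 1 / real n"
    by (intro LIMSEQ_le_const2) auto
  then show "pi\<^sup>2 / 6 \<le> (\<Sum>m\<in>{1..n}. 1 / (real m)\<^sup>2) + 1 / real n"
    unfolding eq .
qed

text \<open>Grouping \<open>\<Sum>\<^bsub>n \<le> X\<^esub> n\<^sup>-\<^sup>2 \<Sum>\<^bsub>d dvd n\<^esub> \<mu>(d) = 1\<close> by \<open>d\<close> gives
  \<open>\<Sum>\<^bsub>d \<le> X\<^esub> \<mu>(d) d\<^sup>-\<^sup>2 (\<zeta>(2) + O(d/X)) = 1\<close>.\<close>

lemma sum_moebius_over_squares:
  assumes X: "X > 0"
  shows "\<bar>(\<Sum>d\<in>{1..X}. moebius_mu d / (real d)\<^sup>2) - 6 / pi\<^sup>2\<bar> \<le> 2 * harm X / real X"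
proof -
  define Z where "Z n = (\<Sum>m\<in>{1..n}. 1 / (real m)\<^sup>2)" for n :: nat
  define z where "z = pi\<^sup>2 / 6"
  have z1: "z \<ge> 1"
    using zeta2_partial_sum_bounds(1)[of 1] by (simp add: z_def)
  have "1 = (\<Sum>n\<in>{1..X}. if n = 1 then 1 else 0 :: real)"
    using X by (simp add: sum.delta)
  also have "\<dots> = (\<Sum>n\<in>{1..X}. 1 / (real n)\<^sup>2 * (if n = 1 then 1 else 0))"
    by (intro sum.cong refl) auto
  also have "\<dots> = (\<Sum>n\<in>{1..X}. 1 / (real n)\<^sup>2 * (\<Sum>d\<in>{1..X}. if d dvd n then moebius_mu d else 0))"
    by (intro sum.cong refl, subst sum_moebius_dvd) auto
  also have "\<dots> = (\<Sum>n\<in>{1..X}. \<Sum>d\<in>{1..X}. if d dvd n then moebius_mu d / (real n)\<^sup>2 else 0)"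
    unfolding sum_distrib_left by (intro sum.cong refl) auto
  also have "\<dots> = (\<Sum>d\<in>{1..X}. \<Sum>n\<in>{1..X}. if d dvd n then moebius_mu d / (real n)\<^sup>2 else 0)"
    by (rule sum.swap)
  also have "\<dots> = (\<Sum>d\<in>{1..X}. moebius_mu d / (real d)\<^sup>2 * Z (X div d))"
  proof (intro sum.cong refl)
    fix d assume d: "d \<in> {1..X}"
    have "(\<Sum>n\<in>{1..X}. if d dvd n then moebius_mu d / (real n)\<^sup>2 else 0) = (\<Sum>n\<in>{n\<in>{1..X}. d dvd n}. moebius_mu d / (real n)\<^sup>2)"
      by (rule sum.inter_filter[symmetric]) simp
    also have "\<dots> = (\<Sum>m\<in>{1..X div d}. moebius_mu d / (real d)\<^sup>2 * (1 / (real m)\<^sup>2))"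
      by (rule sum.reindex_bij_witness[of _ "\<lambda>m. d * m" "\<lambda>n. n div d"])
        (use d in \<open>auto simp: less_eq_div_iff_mult_less_eq mult.commute power_mult_distrib elim!: dvdE\<close>)
    finally show "(\<Sum>n\<in>{1..X}. if d dvd n then moebius_mu d / (real n)\<^sup>2 else 0) = moebius_mu d / (real d)\<^sup>2 * Z (X div d)"
      by (simp add: Z_def sum_distrib_left)
  qed
  finally have one: "(\<Sum>d\<in>{1..X}. moebius_mu d / (real d)\<^sup>2 * Z (X div d)) = 1" by simp
  have "\<bar>(\<Sum>d\<in>{1..X}. moebius_mu d / (real d)\<^sup>2) * z - 1\<bar> = \<bar>\<Sum>d\<in>{1..X}. moebius_mu d / (real d)\<^sup>2 * (z - Z (X div d))\<bar>"
    unfolding right_diff_distrib sum_subtractf sum_distrib_right[symmetric] one ..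
  also have "\<dots> \<le> (\<Sum>d\<in>{1..X}. 2 / real X * inverse (real d))"
  proof (rule order_trans[OF sum_abs], intro sum_mono)
    fix d assume d: "d \<in> {1..X}"
    have q: "X div d > 0" using d by (simp add: div_greater_zero_iff)
    \<comment> \<open>Because X div d is positive, it is at least X / (2 d); the zeta(2) tail beyond
      it is therefore at most 2 d / X.\<close>
    have "X < d * (X div d) + d" 
      using mult_div_mod_eq[of d X] mod_less_divisor[of d X] d by (simp only: atLeastAtMost_iff) linarith
    also have "\<dots> \<le> d * (2 * (X div d))" using q by simp
    finally have "real X \<le> real (d * (2 * (X div d)))" by (intro of_nat_mono) simp
    then have "1 / real (X div d) \<le> 2 * real d / real X"
      using q X by (simp add: field_simps)
    then have Z: "\<bar>z - Z (X div d)\<bar> \<le> 2 * real d / real X"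
      using zeta2_partial_sum_bounds[OF q] by (auto simp: z_def Z_def abs_le_iff)
    have "\<bar>moebius_mu d / (real d)\<^sup>2 * (z - Z (X div d))\<bar> = \<bar>moebius_mu d\<bar> * \<bar>z - Z (X div d)\<bar> / (real d)\<^sup>2"
      by (simp add: abs_mult)
    also have "\<dots> \<le> 1 * (2 * real d / real X) / (real d)\<^sup>2"
      by (intro divide_right_mono mult_mono abs_moebius_le Z) auto
    also have "\<dots> = 2 / real X * inverse (real d)"
      using d by (simp add: power2_eq_square field_simps)
    finally show "\<bar>moebius_mu d / (real d)\<^sup>2 * (z - Z (X div d))\<bar> \<le> 2 / real X * inverse (real d)" .
  qed
  also have "\<dots> = 2 * harm X / real X"
    by (simp add: harm_def sum_distrib_left sum_divide_distrib)
  finally have main: "\<bar>(\<Sum>d\<in>{1..X}. moebius_mu d / (real d)\<^sup>2) * z - 1\<bar> \<le> 2 * harm X / real X" .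
  \<comment> \<open>Dividing by zeta(2), which is at least 1, does not enlarge the error.\<close>
  have "y - 6 / pi\<^sup>2 = (y * z - 1) / z" for y
    by (simp add: z_def field_simps)
  then have "\<bar>(\<Sum>d\<in>{1..X}. moebius_mu d / (real d)\<^sup>2) - 6 / pi\<^sup>2\<bar> = \<bar>((\<Sum>d\<in>{1..X}. moebius_mu d / (real d)\<^sup>2) * z - 1) / z\<bar>"
    by (simp only:)
  also have "\<dots> = \<bar>(\<Sum>d\<in>{1..X}. moebius_mu d / (real d)\<^sup>2) * z - 1\<bar> / z"
    using z1 by simp
  also have "\<dots> \<le> \<bar>(\<Sum>d\<in>{1..X}. moebius_mu d / (real d)\<^sup>2) * z - 1\<bar> / 1"
    using z1 by (intro divide_left_mono) auto
  finally show ?thesis using main by simp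
qed

section \<open>The asymptotic formula\<close>

lemma card_common_multiples:
  assumes "d > 0"
  shows "card {(x, y) \<in> {(x, y) \<in> {1..K} \<times> {1..N}. [y = a * g ^ x] (mod p)}. d dvd x \<and> d dvd y}
    = card (multiple_points p a g K N d)"
proof (rule bij_betw_same_card)
  show "bij_betw (\<lambda>(x, y). (x div d, y div d))
      {(x, y) \<in> {(x, y) \<in> {1..K} \<times> {1..N}. [y = a * g ^ x] (mod p)}. d dvd x \<and> d dvd y}
      (multiple_points p a g K N d)"
    by (rule bij_betwI[where g = "\<lambda>(u, v). (d * u, d * v)"])
      (use assms in \<open>auto simp: multiple_points_def less_eq_div_iff_mult_less_eq mult.commute elim!: dvdE\<close>)
qed

lemma sum_dyadic:
  fixes f :: "nat \<Rightarrow> nat"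
  shows "(\<Sum>d\<in>{D..<D * 2 ^ n}. f d) = (\<Sum>k<n. \<Sum>d\<in>{D * 2 ^ k..<2 * (D * 2 ^ k)}. f d)"
proof (induction n)
  case (Suc n)
  have "(\<Sum>d\<in>{D..<D * 2 ^ Suc n}. f d) = (\<Sum>d\<in>{D..<D * 2 ^ n}. f d) + (\<Sum>d\<in>{D * 2 ^ n..<2 * (D * 2 ^ n)}. f d)"
    by (subst sum.atLeastLessThan_concat) (auto simp: mult_ac)
  then show ?case using Suc by simp
qed simp

section \<open>From integer boxes to real bounds\<close>

lemma div_nat_floor_bounds:
  assumes "U \<ge> 0" "d > 0"
  shows "real (nat \<lfloor>U\<rfloor> div d) \<le> U / real d" "U / real d \<le> real (nat \<lfloor>U\<rfloor> div d) + 1"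
proof -
  have "real (nat \<lfloor>U\<rfloor> div d) \<le> real (nat \<lfloor>U\<rfloor>) / real d" by (rule of_nat_div_le_of_nat)
  also have "\<dots> \<le> U / real d" using assms by (intro divide_right_mono) auto
  finally show "real (nat \<lfloor>U\<rfloor> div d) \<le> U / real d" .
  have "nat \<lfloor>U\<rfloor> < d * (nat \<lfloor>U\<rfloor> div d) + d"
    using mult_div_mod_eq[of d "nat \<lfloor>U\<rfloor>"] mod_less_divisor[of d "nat \<lfloor>U\<rfloor>"] assms(2) by linarith
  then have "nat \<lfloor>U\<rfloor> + 1 \<le> d * (nat \<lfloor>U\<rfloor> div d + 1)" by simp
  then have "real (nat \<lfloor>U\<rfloor> + 1) \<le> real (d * (nat \<lfloor>U\<rfloor> div d + 1))" by (rule of_nat_mono)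
  moreover have "U \<le> real (nat \<lfloor>U\<rfloor> + 1)" using assms by linarith
  ultimately have "U \<le> real d * (real (nat \<lfloor>U\<rfloor> div d) + 1)" by (simp add: distrib_left)
  then show "U / real d \<le> real (nat \<lfloor>U\<rfloor> div d) + 1"
    using assms by (simp add: field_simps)
qed

lemma prod_diff_floor_le:
  fixes A B \<alpha> \<beta> :: real
  assumes "0 \<le> \<alpha>" "\<alpha> \<le> A" "A \<le> \<alpha> + 1" "0 \<le> \<beta>" "\<beta> \<le> B" "B \<le> \<beta> + 1"
  shows "\<bar>\<alpha> * \<beta> - A * B\<bar> \<le> A + B"
proof -
  have "\<alpha> * \<beta> \<le> A * B" using assms by (intro mult_mono) auto
  moreover have "A * B - \<alpha> * \<beta> = A * (B - \<beta>) + \<beta> * (A - \<alpha>)" by (simp add: algebra_simps)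
  moreover have "A * (B - \<beta>) \<le> A * 1" "\<beta> * (A - \<alpha>) \<le> \<beta> * 1"
    using assms by (intro mult_left_mono; simp)+
  ultimately show ?thesis using assms by linarith
qed

text \<open>Rounding changes the main term by at most (U/d + V/d) / p <= 2, which the completion
  error absorbs; hence the factor 2.\<close>

lemma card_multiple_points_real:
  assumes p: "prime p" and g: "coprime p g" and a: "coprime a p"
    and U: "0 \<le> U" "U \<le> real (ord p g)" "U \<le> real p" and V: "0 \<le> V" "V < real p"
    and d: "0 < d" "d < p"
  shows "\<bar>real (card (multiple_points p a g (nat \<lfloor>U\<rfloor>) (nat \<lfloor>V\<rfloor>) d)) - U * V / real p / (real d)\<^sup>2\<bar>
    \<le> 2 * sqrt (real p) * (3 + 2 * ln (real p))\<^sup>2"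
proof -
  define \<alpha> where "\<alpha> = real (nat \<lfloor>U\<rfloor> div d)"
  define \<beta> where "\<beta> = real (nat \<lfloor>V\<rfloor> div d)"
  have p1: "real p \<ge> 1" using p prime_ge_1_nat by simp
  have K: "nat \<lfloor>U\<rfloor> \<le> ord p g" "nat \<lfloor>V\<rfloor> < p"
    using U V by (auto simp: nat_le_iff nat_less_iff floor_le_iff floor_less_iff intro: order_trans)
  have 1: "\<bar>real (card (multiple_points p a g (nat \<lfloor>U\<rfloor>) (nat \<lfloor>V\<rfloor>) d)) - \<alpha> * \<beta> / real p\<bar>
      \<le> sqrt (real p) * (3 + 2 * ln (real p))\<^sup>2"
    unfolding \<alpha>_def \<beta>_def by (rule card_multiple_points[OF p g a K d])
  have "\<bar>\<alpha> * \<beta> - U / real d * (V / real d)\<bar> \<le> U / real d + V / real d"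
    unfolding \<alpha>_def \<beta>_def using div_nat_floor_bounds[OF U(1) d(1)] div_nat_floor_bounds[OF V(1) d(1)]
    by (intro prod_diff_floor_le) auto
  also have "\<dots> \<le> U / 1 + V / 1"
    using U V d by (intro add_mono divide_left_mono) auto
  also have "\<dots> \<le> 2 * real p" using U V by simp
  finally have "\<bar>\<alpha> * \<beta> - U / real d * (V / real d)\<bar> / real p \<le> 2"
    using p1 by (simp add: field_simps)
  moreover have "\<bar>\<alpha> * \<beta> / real p - U * V / real p / (real d)\<^sup>2\<bar> = \<bar>(\<alpha> * \<beta> - U / real d * (V / real d)) / real p\<bar>"
    by (simp add: diff_divide_distrib power2_eq_square mult_ac)
  ultimately have 2: "\<bar>\<alpha> * \<beta> / real p - U * V / real p / (real d)\<^sup>2\<bar> \<le> 2" by simp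
  have "1 * 3\<^sup>2 \<le> sqrt (real p) * (3 + 2 * ln (real p))\<^sup>2"
    using p1 by (intro mult_mono power_mono) auto
  then have 3: "2 \<le> sqrt (real p) * (3 + 2 * ln (real p))\<^sup>2" by simp
  show ?thesis
    unfolding mult.assoc using 1 2 3 by (simp only: mult.assoc abs_le_iff) linarith
qed

text \<open>The two dyadic bounds meet at \<Delta> = U^(2/3). From there on the second gives
  (U/\<Delta>) sqrt V <= U^(1/3) sqrt V. Below it, the first has the terms \<Delta> V <= U^(2/3) V =
  (U^(1/3) sqrt V)^2 and, up to a logarithm, U V / \<Delta> <= U V / D.\<close>

lemma card_dyadic_points_real:
  assumes p: "prime p" and g: "coprime p g" and a: "coprime a p"
    and U: "1 \<le> U" "U \<le> real (ord p g)" "U < real p" and V: "0 \<le> V" "V < real p"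
    and E: "E \<ge> 0" "U powr (1 / 3) * sqrt V \<le> E" "U * V / D \<le> E\<^sup>2" and D: "0 < D" "D \<le> real \<Delta>"
  shows "real (card (dyadic_points p a g (nat \<lfloor>U\<rfloor>) (nat \<lfloor>V\<rfloor>) \<Delta>)) \<le> 17 * (3 + 2 * ln (real p)) * E"
proof -
  define K where "K = nat \<lfloor>U\<rfloor>"
  define N where "N = nat \<lfloor>V\<rfloor>"
  define W where "W = real (card (dyadic_points p a g K N \<Delta>))"
  define l where "l = 3 + 2 * ln (real p)"
  have p1: "real p \<ge> 1" using p prime_ge_1_nat by simp
  have l: "l \<ge> 3" using p1 by (simp add: l_def)
  have K: "K \<le> ord p g" "K < p" "N < p"
    using U V by (auto simp: K_def N_def nat_le_iff nat_less_iff floor_le_iff floor_less_iff intro: order_trans)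
  have KU: "real K \<le> U" "real N \<le> V" using U V by (auto simp: K_def N_def)
  have \<Delta>: "\<Delta> > 0" using D by (intro Nat.gr0I) auto
  have "W \<le> 17 * l * E"
  proof (cases "U powr (2 / 3) \<le> real \<Delta>")
    case True
    have "W \<le> real (K div \<Delta>) * sqrt (3 * real N)"
      unfolding W_def by (rule card_dyadic_points_le_sqrt[OF p g a K(2,3) \<Delta>])
    also have "\<dots> \<le> (U / U powr (2 / 3)) * (2 * sqrt V)"
    proof (intro mult_mono)
      have "real (K div \<Delta>) \<le> real K / real \<Delta>" by (rule of_nat_div_le_of_nat)
      also have "\<dots> \<le> U / U powr (2 / 3)" using KU U True by (intro frac_le) auto
      finally show "real (K div \<Delta>) \<le> U / U powr (2 / 3)" .
      have "sqrt (3 * real N) \<le> sqrt (4 * V)" using KU V by (intro real_sqrt_le_mono) auto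
      then show "sqrt (3 * real N) \<le> 2 * sqrt V" by (simp add: real_sqrt_mult)
    qed (use U in auto)
    also have "U / U powr (2 / 3) = U powr (1 / 3)"
      using powr_diff[of U 1 "2 / 3"] U by simp
    also have "U powr (1 / 3) * (2 * sqrt V) \<le> 2 * E" using E by simp
    also have "\<dots> \<le> (17 * l) * E" using l E by (intro mult_right_mono) auto
    finally show ?thesis .
  next
    case False
    have \<Delta>U: "real \<Delta> \<le> U"
      using False U powr_mono[of "2 / 3" 1 U] by simp
    have "harm (2 * \<Delta>) \<le> 1 + ln (real (2 * \<Delta>))"
      using \<Delta> by (intro harm_le_one_plus_ln) simp
    also have "ln (real (2 * \<Delta>)) = ln 2 + ln (real \<Delta>)" using \<Delta> by (simp add: ln_mult)
    also have "1 + (ln 2 + ln (real \<Delta>)) \<le> 1 + (1 + ln (real p))"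
      using \<Delta> \<Delta>U U ln_2_less_1 by (intro add_mono) auto
    also have "\<dots> \<le> l" using p1 by (simp add: l_def)
    finally have H: "harm (2 * \<Delta>) \<le> l" .
    have *: "U * V / real \<Delta> \<le> E\<^sup>2"
    proof -
      have "U * V / real \<Delta> \<le> U * V / D" using U V D by (intro divide_left_mono) auto
      then show ?thesis using E by linarith
    qed
    have **: "real \<Delta> * V \<le> E\<^sup>2"
    proof -
      have "real \<Delta> * V \<le> U powr (2 / 3) * V" using False V by (intro mult_right_mono) auto
      also have "\<dots> = (U powr (1 / 3) * sqrt V)\<^sup>2"
        using U V by (simp add: power_mult_distrib powr_power)
      also have "\<dots> \<le> E\<^sup>2" using E U V by (intro power_mono) auto
      finally show ?thesis .
    qed
    have "W\<^sup>2 \<le> 32 * (real N / real \<Delta>) * ((real \<Delta>)\<^sup>2 + 8 * real K * harm (2 * \<Delta>))"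
      unfolding W_def by (rule card_dyadic_points_power2_le[OF p g a K \<Delta>])
    also have "\<dots> \<le> 32 * (V / real \<Delta>) * ((real \<Delta>)\<^sup>2 + 8 * U * l)"
      using KU U V l H by (intro mult_mono add_mono divide_right_mono mult_left_mono) (auto simp: harm_nonneg)
    also have "\<dots> = 32 * (real \<Delta> * V) + 256 * l * (U * V / real \<Delta>)"
      using \<Delta> by (simp add: power2_eq_square field_simps)
    also have "\<dots> \<le> 32 * E\<^sup>2 + 256 * l * E\<^sup>2"
      using * ** l by (intro add_mono mult_left_mono) auto
    \<comment> \<open>The constant is 17 because 17^2 = 289 exceeds 32 + 256.\<close>
    also have "\<dots> \<le> (17 * l * E)\<^sup>2"
    proof -
      have "32 + 256 * l \<le> (17 * l) * (17 * l)"
      proof -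
        have "3 * l \<le> l * l" using l by (intro mult_right_mono) auto
        moreover have "(17 * l) * (17 * l) = 289 * (l * l)" by simp
        ultimately show ?thesis using l by linarith
      qed
      then have "(32 + 256 * l) * E\<^sup>2 \<le> ((17 * l) * (17 * l)) * E\<^sup>2"
        by (intro mult_right_mono) auto
      then show ?thesis by (simp add: power2_eq_square algebra_simps)
    qed
    finally show ?thesis
      by (rule power2_le_imp_le) (use l E in auto)
  qed
  then show ?thesis by (simp add: W_def l_def K_def N_def)
qed

text \<open>Bounds the number of dyadic ranges by the same logarithmic factor that completion
  produces; ln 2 >= 1/2 converts the base.\<close>

lemma exists_dyadic_length:
  assumes "p > 0"
  obtains n :: nat where "p \<le> 2 ^ n" "real n \<le> 3 + 2 * ln (real p)"
proof -
  define n where "n = nat \<lceil>log 2 (real p)\<rceil>"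
  have p: "real p \<ge> 1" using assms by simp
  then have l0: "log 2 (real p) \<ge> 0" by simp
  then have n: "log 2 (real p) \<le> real n" "real n \<le> log 2 (real p) + 1"
    unfolding n_def by linarith+
  have "real p = 2 powr (log 2 (real p))" using p by simp
  also have "\<dots> \<le> 2 powr (real n)" using n by (intro powr_mono) auto
  also have "\<dots> = real (2 ^ n)" by (simp add: powr_realpow)
  finally have 1: "p \<le> 2 ^ n" by (simp only: of_nat_le_iff)
  have "log 2 (real p) = ln (real p) / ln 2" by (simp add: log_def)
  also have "\<dots> \<le> ln (real p) / (1 / 2)"
    using ln2_ge_two_thirds p by (intro divide_left_mono) auto
  finally have "real n \<le> 3 + 2 * ln (real p)" using n by simp
  with 1 show thesis by (rule that)
qed

text \<open>The constant 23 is 2 + 4 + 17: the completion errors for d up to D, the truncation of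
  the Moebius series at D, and the dyadic ranges beyond D. The last hypothesis on E says U V / D <=
  E^2.\<close>

lemma visible_count_core:
  fixes p a g :: nat and U V E :: real
  assumes p: "prime p" and g: "coprime p g" and a: "coprime a p"
    and U: "1 \<le> U" "U \<le> real (ord p g)" "U < real p" and V: "0 \<le> V" "V < real p"
    and E: "sqrt (real p) \<le> E" "E \<le> real p" "U powr (1 / 3) * sqrt V \<le> E" "U * V * sqrt (real p) \<le> E ^ 3"
  shows "\<bar>real (card {(x, y) \<in> {(x, y) \<in> {1..nat \<lfloor>U\<rfloor>} \<times> {1..nat \<lfloor>V\<rfloor>}. [y = a * g ^ x] (mod p)}. coprime x y})
      - 6 / pi\<^sup>2 * (U * V / real p)\<bar> \<le> 23 * (3 + 2 * ln (real p))\<^sup>2 * E"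
proof -
  define l where "l = 3 + 2 * ln (real p)"
  define K where "K = nat \<lfloor>U\<rfloor>"
  define N where "N = nat \<lfloor>V\<rfloor>"
  define m where "m d = real (card (multiple_points p a g K N d))" for d
  \<comment> \<open>At this cutoff the D completion errors of size sqrt p add up to E, apart from
    logarithms.\<close>
  define D where "D = E / sqrt (real p)"
  define D0 where "D0 = nat \<lfloor>D\<rfloor>"
  define Q where "Q = U * V / real p"
  have p1: "real p > 1" using p prime_gt_1_nat by simp
  have l: "l \<ge> 3" using p1 by (simp add: l_def)
  have D: "D \<ge> 1" "D \<le> sqrt (real p)"
  proof -
    show "D \<ge> 1" using E p1 by (simp add: D_def)
    have "D \<le> real p / sqrt (real p)" unfolding D_def using E by (intro divide_right_mono) auto
    then show "D \<le> sqrt (real p)" by (simp add: real_div_sqrt)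
  qed
  have sp: "sqrt (real p) < real p"
    using p1 real_sqrt_less_mono[of "real p" "(real p)\<^sup>2"] by (simp add: power2_eq_square)
  have D0: "real D0 \<le> D" "D < real D0 + 1" "D0 \<ge> 1"
    using D unfolding D0_def by linarith+
  have D0p: "D0 < p"
  proof -
    have "real D0 < real p" using D0 D sp by linarith
    then show ?thesis by simp
  qed
  have E0: "E > 0" using E p1 by (smt (verit) real_sqrt_gt_0_iff)
  have UVD: "U * V / D \<le> E\<^sup>2"
  proof -
    have "U * V / D = U * V * sqrt (real p) / E" by (simp add: D_def)
    also have "\<dots> \<le> E ^ 3 / E" using E E0 by (intro divide_right_mono) auto
    also have "\<dots> = E\<^sup>2" using E0 by (simp add: power3_eq_cube power2_eq_square)
    finally show ?thesis .
  qed
  have "p > 0" using p1 by simp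
  then obtain n where n: "p \<le> 2 ^ n" "real n \<le> l"
    unfolding l_def by (rule exists_dyadic_length)
  \<comment> \<open>X is at least K, so no common divisor is missed, and D0 + 1 up to X consists of
    exactly n half-open dyadic ranges, whence the - 1.\<close>
  define X where "X = (D0 + 1) * 2 ^ n - 1"
  have X: "{1..X} = {1..D0} \<union> {D0 + 1..<(D0 + 1) * 2 ^ n}" "K \<le> X"
  proof -
    have "(D0 + 1) * 1 \<le> (D0 + 1) * 2 ^ n" by (intro mult_le_mono2) simp
    then have "D0 + 1 \<le> (D0 + 1) * 2 ^ n" by (simp only: mult_1_right)
    then show "{1..X} = {1..D0} \<union> {D0 + 1..<(D0 + 1) * 2 ^ n}"
      by (auto simp: X_def)
    have "K < p" using U by (auto simp: K_def nat_less_iff floor_less_iff)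
    also have "p \<le> 2 ^ n" by (rule n)
    also have "\<dots> \<le> (D0 + 1) * 2 ^ n" by simp
    finally show "K \<le> X" by (simp add: X_def)
  qed
  let ?S = "{(x, y) \<in> {1..K} \<times> {1..N}. [y = a * g ^ x] (mod p)}"
  have "real (card {(x, y) \<in> ?S. coprime x y})
      = (\<Sum>d\<in>{1..X}. moebius_mu d * real (card {(x, y) \<in> ?S. d dvd x \<and> d dvd y}))"
  proof (rule card_coprime_eq_sum_moebius)
    show "finite ?S" by (rule finite_subset[of _ "{1..K} \<times> {1..N}"]) auto
    show "0 < x \<and> x \<le> X" if "(x, y) \<in> ?S" for x y using that X by auto
  qed
  also have "\<dots> = (\<Sum>d\<in>{1..X}. moebius_mu d * m d)"
    unfolding m_def by (intro sum.cong refl arg_cong2[of _ _ _ _ "(*)"] arg_cong[of _ _ real] card_common_multiples) auto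
  also have "\<dots> = (\<Sum>d\<in>{1..D0}. moebius_mu d * m d) + (\<Sum>d\<in>{D0 + 1..<(D0 + 1) * 2 ^ n}. moebius_mu d * m d)"
    unfolding X by (rule sum.union_disjoint) auto
  finally have vis: "real (card {(x, y) \<in> ?S. coprime x y})
      = (\<Sum>d\<in>{1..D0}. moebius_mu d * m d) + (\<Sum>d\<in>{D0 + 1..<(D0 + 1) * 2 ^ n}. moebius_mu d * m d)" .
  have mu: "\<bar>moebius_mu d * y\<bar> \<le> \<bar>y\<bar>" for d y
    using abs_moebius_le[of d] mult_right_mono[of "\<bar>moebius_mu d\<bar>" 1 "\<bar>y\<bar>"] by (simp add: abs_mult)
  have small: "\<bar>(\<Sum>d\<in>{1..D0}. moebius_mu d * m d) - Q * (\<Sum>d\<in>{1..D0}. moebius_mu d / (real d)\<^sup>2)\<bar> \<le> 2 * l\<^sup>2 * E"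
  proof -
    have "(\<Sum>d\<in>{1..D0}. moebius_mu d * m d) - Q * (\<Sum>d\<in>{1..D0}. moebius_mu d / (real d)\<^sup>2)
        = (\<Sum>d\<in>{1..D0}. moebius_mu d * (m d - Q / (real d)\<^sup>2))"
      by (simp add: sum_distrib_left sum_subtractf right_diff_distrib mult_ac)
    also have "\<bar>\<dots>\<bar> \<le> (\<Sum>d\<in>{1..D0}. \<bar>m d - Q / (real d)\<^sup>2\<bar>)"
      by (rule order_trans[OF sum_abs]) (intro sum_mono mu)
    also have "\<dots> \<le> (\<Sum>d\<in>{1..D0}. 2 * sqrt (real p) * l\<^sup>2)"
      unfolding m_def Q_def K_def N_def l_def using U V D0p
      by (intro sum_mono card_multiple_points_real[OF p g a]) auto
    also have "\<dots> = real D0 * (2 * sqrt (real p) * l\<^sup>2)" by simp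
    also have "\<dots> \<le> D * (2 * sqrt (real p) * l\<^sup>2)"
      using D0 by (intro mult_right_mono) auto
    also have "\<dots> = 2 * l\<^sup>2 * E" using p1 by (simp add: D_def)
    finally show ?thesis .
  qed
  have main: "\<bar>Q * (\<Sum>d\<in>{1..D0}. moebius_mu d / (real d)\<^sup>2) - 6 / pi\<^sup>2 * Q\<bar> \<le> 4 * l\<^sup>2 * E"
  proof -
    have Q0: "Q \<ge> 0" using U V by (simp add: Q_def)
    have "harm D0 \<le> 1 + ln (real D0)" using D0 by (intro harm_le_one_plus_ln) simp
    also have "\<dots> \<le> 1 + ln (real p)" using D0 D0p by simp
    also have "\<dots> \<le> l" using p1 by (simp add: l_def)
    finally have H: "harm D0 \<le> l" .
    have "Q * y - 6 / pi\<^sup>2 * Q = Q * (y - 6 / pi\<^sup>2)" for y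
      by (simp add: right_diff_distrib)
    then have "\<bar>Q * (\<Sum>d\<in>{1..D0}. moebius_mu d / (real d)\<^sup>2) - 6 / pi\<^sup>2 * Q\<bar>
        = Q * \<bar>(\<Sum>d\<in>{1..D0}. moebius_mu d / (real d)\<^sup>2) - 6 / pi\<^sup>2\<bar>"
      by (simp only: abs_mult abs_of_nonneg[OF Q0])
    also have "\<dots> \<le> Q * (2 * harm D0 / real D0)"
      using D0 Q0 by (intro mult_left_mono sum_moebius_over_squares) auto
    also have "\<dots> \<le> Q * (2 * l / (D / 2))"
    proof (intro mult_left_mono frac_le)
      \<comment> \<open>D < D0 + 1 <= 2 D0, since D0 is at least 1.\<close>
      show "D / 2 \<le> real D0" using D0 by linarith
    qed (use D Q0 H l in auto)
    also have "\<dots> = 4 * l * ((U * V / D) / real p)" by (simp add: Q_def mult_ac)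
    also have "\<dots> \<le> 4 * l * (E\<^sup>2 / real p)"
      using UVD l by (intro mult_left_mono divide_right_mono) auto
    also have "\<dots> \<le> 4 * l * E"
    proof (intro mult_left_mono)
      have "E * E \<le> E * real p" using E E0 by (intro mult_left_mono) auto
      then show "E\<^sup>2 / real p \<le> E" using p1 by (simp add: power2_eq_square field_simps)
    qed (use l in auto)
    also have "\<dots> \<le> 4 * l\<^sup>2 * E"
      using l E0 by (intro mult_right_mono mult_left_mono) (auto simp: power2_eq_square)
    finally show ?thesis .
  qed
  have tail: "\<bar>\<Sum>d\<in>{D0 + 1..<(D0 + 1) * 2 ^ n}. moebius_mu d * m d\<bar> \<le> 17 * l\<^sup>2 * E"
  proof -
    have "\<bar>\<Sum>d\<in>{D0 + 1..<(D0 + 1) * 2 ^ n}. moebius_mu d * m d\<bar> \<le> (\<Sum>d\<in>{D0 + 1..<(D0 + 1) * 2 ^ n}. \<bar>m d\<bar>)"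
      by (rule order_trans[OF sum_abs]) (intro sum_mono mu)
    also have "\<dots> = real (\<Sum>d\<in>{D0 + 1..<(D0 + 1) * 2 ^ n}. card (multiple_points p a g K N d))"
      by (simp add: m_def)
    also have "\<dots> = (\<Sum>k<n. real (card (dyadic_points p a g K N ((D0 + 1) * 2 ^ k))))"
      unfolding sum_dyadic card_dyadic_points by simp
    also have "\<dots> \<le> (\<Sum>k<n. 17 * l * E)"
    proof (intro sum_mono)
      fix k
      have "D \<le> real (D0 + 1) * 1" using D0 by simp
      also have "\<dots> \<le> real (D0 + 1) * 2 ^ k" by (intro mult_left_mono) auto
      finally have "D \<le> real ((D0 + 1) * 2 ^ k)" by (simp add: distrib_right)
      then show "real (card (dyadic_points p a g K N ((D0 + 1) * 2 ^ k))) \<le> 17 * l * E"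
        unfolding K_def N_def l_def using E E0 UVD D
        by (intro card_dyadic_points_real[OF p g a U V, where D = D]) auto
    qed
    also have "\<dots> = real n * (17 * l * E)" by simp
    also have "\<dots> \<le> l * (17 * l * E)" using n l E0 by (intro mult_right_mono) auto
    finally show ?thesis by (simp add: power2_eq_square)
  qed
  have "\<bar>real (card {(x, y) \<in> ?S. coprime x y}) - 6 / pi\<^sup>2 * Q\<bar> \<le> 2 * l\<^sup>2 * E + 4 * l\<^sup>2 * E + 17 * l\<^sup>2 * E"
    using small main tail unfolding vis by linarith
  also have "\<dots> = 23 * l\<^sup>2 * E" by simp
  finally show ?thesis unfolding K_def N_def l_def Q_def .
qed

text \<open>Here the main term itself is at most E, and the count is at most
  \<open>M\<^sub>1\<close>, which is the main term without 6/\<pi>^2 plus a completion error. The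
  constant is chosen to match the other case.\<close>

lemma visible_count_trivial:
  fixes p a g :: nat and U V E :: real
  assumes p: "prime p" and g: "coprime p g" and a: "coprime a p"
    and U: "0 \<le> U" "U \<le> real (ord p g)" "U < real p" and V: "0 \<le> V" "V < real p"
    and E: "sqrt (real p) \<le> E" "U * V / real p \<le> E"
  shows "\<bar>real (card {(x, y) \<in> {(x, y) \<in> {1..nat \<lfloor>U\<rfloor>} \<times> {1..nat \<lfloor>V\<rfloor>}. [y = a * g ^ x] (mod p)}. coprime x y})
      - 6 / pi\<^sup>2 * (U * V / real p)\<bar> \<le> 23 * (3 + 2 * ln (real p))\<^sup>2 * E"
proof -
  define l where "l = 3 + 2 * ln (real p)"
  define Q where "Q = U * V / real p"
  let ?S = "{(x, y) \<in> {1..nat \<lfloor>U\<rfloor>} \<times> {1..nat \<lfloor>V\<rfloor>}. [y = a * g ^ x] (mod p)}"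
  have p1: "p > 1" using p prime_gt_1_nat by simp
  have l: "l \<ge> 3" using p1 by (simp add: l_def)
  \<comment> \<open>The conditions \<open>1 dvd\<close> put the full point set into the form of the
    common-multiple count at d = 1.\<close>
  have "card {(x, y) \<in> ?S. coprime x y} \<le> card {(x, y) \<in> ?S. 1 dvd x \<and> 1 dvd y}"
  proof (rule card_mono)
    show "finite {(x, y) \<in> ?S. 1 dvd x \<and> 1 dvd y}"
      by (rule finite_subset[of _ "{1..nat \<lfloor>U\<rfloor>} \<times> {1..nat \<lfloor>V\<rfloor>}"]) auto
  qed auto
  then have "real (card {(x, y) \<in> ?S. coprime x y}) \<le> real (card (multiple_points p a g (nat \<lfloor>U\<rfloor>) (nat \<lfloor>V\<rfloor>) 1))"
    unfolding card_common_multiples[OF zero_less_one] by (rule of_nat_mono)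
  also have "\<dots> \<le> Q + 2 * sqrt (real p) * l\<^sup>2"
    using card_multiple_points_real[OF p g a U(1,2) _ V, of 1] U p1 by (simp add: Q_def l_def abs_le_iff)
  also have "\<dots> \<le> E + 2 * E * l\<^sup>2"
    using E by (intro add_mono mult_right_mono mult_left_mono) (auto simp: Q_def)
  finally have 1: "real (card {(x, y) \<in> ?S. coprime x y}) \<le> E + 2 * E * l\<^sup>2" .
  have Q0: "Q \<ge> 0" using U V by (simp add: Q_def)
  have "6 / pi\<^sup>2 \<le> 1"
  proof -
    have "3 * 3 \<le> pi * pi" using pi_gt3 by (intro mult_mono) auto
    then show ?thesis by (simp add: power2_eq_square)
  qed
  then have "6 / pi\<^sup>2 * Q \<le> 1 * Q" using Q0 by (intro mult_right_mono)
  also have "1 * Q \<le> E" using E by (simp add: Q_def)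
  finally have 2: "6 / pi\<^sup>2 * Q \<le> E" .
  have E0: "E \<ge> 0" using E by (meson order_trans real_sqrt_ge_zero of_nat_0_le_iff)
  have "1\<^sup>2 \<le> l\<^sup>2" using l by (intro power_mono) auto
  then have 3: "E * 1 \<le> E * l\<^sup>2" using E0 by (intro mult_left_mono) auto
  have "0 \<le> 6 / pi\<^sup>2 * Q" using Q0 by simp
  then have "\<bar>real (card {(x, y) \<in> ?S. coprime x y}) - 6 / pi\<^sup>2 * Q\<bar> \<le> 23 * (E * l\<^sup>2)"
    using 1 2 3 E0 by linarith
  then show ?thesis by (simp add: Q_def l_def mult_ac)
qed

text \<open>In logarithms every claim is linear. The first is the hypothesis on U^6 V rewritten. The
  bounds on U V / P, U^(1/3) sqrt V and U V sqrt P all become equalities at U = P^(3/4), V = P,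
  which explains this threshold.\<close>

lemma error_term_bounds:
  fixes P U V :: real
  assumes P: "P > 1" and U: "0 < U" "U \<le> P" and V: "0 < V" "V \<le> P" and UV: "P powr (15 / 4) \<le> U ^ 6 * V"
  defines "E \<equiv> U powr (6 / 7) * V powr (1 / 7) / P powr (1 / 28)"
  shows "sqrt P \<le> E" "E \<le> P"
    and "U < P powr (3 / 4) \<Longrightarrow> U * V / P \<le> E"
    and "P powr (3 / 4) \<le> U \<Longrightarrow> 1 \<le> U"
    and "P powr (3 / 4) \<le> U \<Longrightarrow> U powr (1 / 3) * sqrt V \<le> E"
    and "P powr (3 / 4) \<le> U \<Longrightarrow> U * V * sqrt P \<le> E ^ 3"
proof -
  define u where "u = ln U"
  define v where "v = ln V"
  define q where "q = ln P"
  have q: "q > 0" using P by (simp add: q_def)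
  have uv: "u \<le> q" "v \<le> q" using U V P by (auto simp: u_def v_def q_def)
  have e: "U = exp u" "V = exp v" "P = exp q" using U V P by (auto simp: u_def v_def q_def)
  have pw: "exp x powr y = exp (y * x)" for x y :: real by (simp add: powr_def)
  have sq: "sqrt (exp x) = exp (x / 2)" for x :: real
    by (rule real_sqrt_unique) (auto simp flip: exp_of_nat_mult)
  have E: "E = exp (6 / 7 * u + 1 / 7 * v - 1 / 28 * q)"
    unfolding E_def e pw by (simp add: exp_add exp_diff)
  have "exp (15 / 4 * q) \<le> exp (6 * u + v)"
    using UV unfolding e pw by (simp add: exp_add flip: exp_of_nat_mult)
  then have key: "15 / 4 * q \<le> 6 * u + v" by simp
  show "sqrt P \<le> E" unfolding E unfolding e sq using key q by simp
  show "E \<le> P" unfolding E unfolding e using uv q by simp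
  show "U * V / P \<le> E" if "U < P powr (3 / 4)"
  proof -
    have "u < 3 / 4 * q" using that unfolding e pw by simp
    then show ?thesis unfolding E unfolding e using uv by (simp flip: exp_add exp_diff)
  qed
  assume "P powr (3 / 4) \<le> U"
  then have u: "3 / 4 * q \<le> u" unfolding e pw by simp
  show "1 \<le> U" unfolding e using u q by simp
  show "U powr (1 / 3) * sqrt V \<le> E"
    unfolding E unfolding e pw sq using u uv by (simp flip: exp_add)
  have "E ^ 3 = exp (3 * (6 / 7 * u + 1 / 7 * v - 1 / 28 * q))"
    unfolding E by (simp flip: exp_of_nat_mult)
  then show "U * V * sqrt P \<le> E ^ 3"
    unfolding e sq using u uv by (simp flip: exp_add)
qed

text \<open>Use ln P <= (2/\<epsilon>) P^(\<epsilon>/2) and 3 <= 3 P^(\<epsilon>/2), then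
  square.\<close>

lemma log_power2_le_powr:
  fixes \<epsilon> P :: real
  assumes \<epsilon>: "\<epsilon> > 0" and P: "P \<ge> 1"
  shows "(3 + 2 * ln P)\<^sup>2 \<le> (3 + 4 / \<epsilon>)\<^sup>2 * P powr \<epsilon>"
proof -
  define z where "z = P powr (\<epsilon> / 2)"
  have z1: "z \<ge> 1" using \<epsilon> P by (simp add: z_def ge_one_powr_ge_zero)
  have "ln P \<le> z / (\<epsilon> / 2)"
    unfolding z_def using \<epsilon> P by (intro ln_powr_bound) auto
  then have "3 + 2 * ln P \<le> 3 * z + 4 / \<epsilon> * z"
    using z1 by simp
  then have "3 + 2 * ln P \<le> (3 + 4 / \<epsilon>) * z" by (simp add: distrib_right)
  then have "(3 + 2 * ln P)\<^sup>2 \<le> ((3 + 4 / \<epsilon>) * z)\<^sup>2"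
    using P by (intro power_mono) auto
  also have "\<dots> = (3 + 4 / \<epsilon>)\<^sup>2 * P powr \<epsilon>"
    using P by (simp add: z_def power_mult_distrib powr_power)
  finally show ?thesis .
qed

section \<open>Reduction from integers to natural residues\<close>

lemma ord_int_eq_ord_nat:
  fixes g :: int
  assumes "p > 0"
  shows "ord (int p) g = ord p (nat (g mod int p))"
proof -
  define h where "h = nat (g mod int p)"
  have h: "int h = g mod int p" using assms by (simp add: h_def)
  have 1: "coprime (int p) g \<longleftrightarrow> coprime p h"
    by (metis coprime_int_iff coprime_iff_gcd_eq_1 gcd.commute gcd_red_int h)
  have 2: "[g ^ d = 1] (mod int p) \<longleftrightarrow> [h ^ d = 1] (mod p)" for d
  proof -
    have "[g ^ d = int (h ^ d)] (mod int p)"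
      by (simp add: h cong_def power_mod)
    then have "[g ^ d = 1] (mod int p) \<longleftrightarrow> [int (h ^ d) = int 1] (mod int p)"
      by (metis cong_sym cong_trans of_nat_1)
    then show ?thesis by (simp only: cong_int_iff)
  qed
  show ?thesis unfolding ord_def 1 2 h_def[symmetric] ..
qed

text \<open>The curve depends only on the residues of a and g, and the coordinates are positive, so
  the count can be carried out in the natural numbers with rounded side lengths.\<close>

lemma num_visible_points_eq_card:
  assumes p: "p > 0"
  shows "num_visible_points a g p U V
    = card {(x, y) \<in> {(x, y) \<in> {1..nat \<lfloor>U\<rfloor>} \<times> {1..nat \<lfloor>V\<rfloor>}.
        [y = nat (a mod int p) * nat (g mod int p) ^ x] (mod p)}. coprime x y}"
    (is "_ = card ?S")
proof -
  have iff: "[int y = a * g ^ x] (mod int p) \<longleftrightarrow> [y = nat (a mod int p) * nat (g mod int p) ^ x] (mod p)" for x y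
  proof -
    have "[a * g ^ x = int (nat (a mod int p) * nat (g mod int p) ^ x)] (mod int p)"
    proof -
      have "int (nat (a mod int p) * nat (g mod int p) ^ x) = (a mod int p) * (g mod int p) ^ x"
        using p by simp
      moreover have "[a * g ^ x = (a mod int p) * (g mod int p) ^ x] (mod int p)"
        by (intro cong_mult cong_pow) (simp_all add: cong_def)
      ultimately show ?thesis by (simp only:)
    qed
    then have "[int y = a * g ^ x] (mod int p) \<longleftrightarrow> [int y = int (nat (a mod int p) * nat (g mod int p) ^ x)] (mod int p)"
      by (metis cong_sym cong_trans)
    then show ?thesis by (simp only: cong_int_iff)
  qed
  have range: "real_of_int (int n) \<in> {1..W} \<longleftrightarrow> n \<in> {1..nat \<lfloor>W\<rfloor>}" for n W
    by (auto simp: le_nat_iff le_floor_iff) linarith+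
  have mem: "(int m, int n) \<in> {(x, y) \<in> exp_curve_points a g p U V. gcd x y = 1} \<longleftrightarrow> (m, n) \<in> ?S" for m n
  proof -
    have "gcd (int m) (int n) = 1 \<longleftrightarrow> coprime m n"
      by (metis coprime_int_iff coprime_iff_gcd_eq_1)
    then show ?thesis
      by (simp only: exp_curve_points_def mem_Collect_eq prod.case range iff nat_int mem_Sigma_iff conj_assoc)
  qed
  have "{(x, y) \<in> exp_curve_points a g p U V. gcd x y = 1} = (\<lambda>(x, y). (int x, int y)) ` ?S"
  proof (intro equalityI subsetI)
    fix z assume z: "z \<in> {(x, y) \<in> exp_curve_points a g p U V. gcd x y = 1}"
    obtain x y where xy: "z = (x, y)" by (cases z)
    have "x \<ge> 0" "y \<ge> 0" using z by (auto simp: xy exp_curve_points_def)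
    then obtain m n where mn: "x = int m" "y = int n" by (metis nonneg_int_cases)
    have "(m, n) \<in> ?S" using z unfolding xy mn mem by simp
    then show "z \<in> (\<lambda>(x, y). (int x, int y)) ` ?S" using xy mn by force
  next
    fix z assume "z \<in> (\<lambda>(x, y). (int x, int y)) ` ?S"
    then obtain m n where mn: "z = (int m, int n)" "(m, n) \<in> ?S" by auto
    then show "z \<in> {(x, y) \<in> exp_curve_points a g p U V. gcd x y = 1}"
      unfolding mn(1) mem by simp
  qed
  moreover have "inj_on (\<lambda>(x, y). (int x, int y)) ?S" by (auto simp: inj_on_def)
  ultimately show ?thesis unfolding num_visible_points_def by (simp only: card_image)
qed

lemma visible_points_asymptotic:
  assumes p: "prime p" and a: "gcd a (int p) = 1" and g: "coprime (int p) g"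
    and U: "U > 0" "U \<le> real (ord (int p) g)" and V: "V > 0" "V \<le> real (ord (int p) g)"
    and UV: "real p powr (15 / 4) \<le> U ^ 6 * V"
  shows "\<bar>real (num_visible_points a g p U V) - 6 / pi\<^sup>2 * (U * V / real p)\<bar>
    \<le> 23 * (3 + 2 * ln (real p))\<^sup>2 * (U powr (6 / 7) * V powr (1 / 7) / real p powr (1 / 28))"
proof -
  define a' where "a' = nat (a mod int p)"
  define g' where "g' = nat (g mod int p)"
  have p1: "p > 1" using p prime_gt_1_nat by simp
  have ord: "ord (int p) g = ord p g'"
    using p1 by (simp add: ord_int_eq_ord_nat g'_def)
  have int: "int a' = a mod int p" "int g' = g mod int p" using p1 by (auto simp: a'_def g'_def)
  have a': "coprime a' p"
    using a int(1) by (metis coprime_int_iff coprime_iff_gcd_eq_1 gcd.commute gcd_red_int)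
  have g': "coprime p g'"
    using g int(2) by (metis coprime_int_iff coprime_iff_gcd_eq_1 gcd.commute gcd_red_int)
  \<comment> \<open>The order divides p - 1, so U and V are strictly below p; all divisors and
    values that occur are then invertible modulo p.\<close>
  have "ord p g' < p"
  proof -
    have "ord p g' dvd totient p" using g' by (intro order_divides_totient)
    then have "ord p g' \<le> p - 1"
      using p p1 by (intro dvd_imp_le) (auto simp: totient_prime)
    then show ?thesis using p1 by simp
  qed
  then have Up: "U \<le> real (ord p g')" "U < real p" "V < real p" using U V ord by auto
  have P: "real p > 1" using p1 by simp
  note bounds = error_term_bounds[OF P U(1) less_imp_le[OF Up(2)] V(1) less_imp_le[OF Up(3)] UV]
  show ?thesis
  proof (cases "U < real p powr (3 / 4)")
    case True
    show ?thesis
      unfolding num_visible_points_eq_card[OF order.strict_trans[OF zero_less_one p1]] a'_def[symmetric] g'_def[symmetric]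
      using U V Up bounds(1,3) True by (intro visible_count_trivial[OF p g' a']) auto
  next
    case False
    show ?thesis
      unfolding num_visible_points_eq_card[OF order.strict_trans[OF zero_less_one p1]] a'_def[symmetric] g'_def[symmetric]
      using V Up bounds(1,2,4,5,6) False by (intro visible_count_core[OF p g' a']) auto
  qed
qed

theorem theorem1p2:
  shows "\<forall>\<epsilon>::real. \<epsilon> > 0 \<longrightarrow>
    (\<exists>C::real. \<forall>(p::nat) (a::int) (g::int) (t::nat) (U::real) (V::real).
       prime p \<longrightarrow> gcd a (int p) = 1 \<longrightarrow>
       coprime (int p) g \<longrightarrow> t = ord (int p) g \<longrightarrow>
       U > 0 \<longrightarrow> V > 0 \<longrightarrow> U \<le> real t \<longrightarrow> V \<le> real t \<longrightarrow>
       U ^ 6 * V \<ge> real p powr (15 / 4) \<longrightarrow>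
       \<bar>real (num_visible_points a g p U V) - 6 / pi\<^sup>2 * (U * V / real p)\<bar>
         \<le> C * ((U powr (6 / 7) * V powr (1 / 7) / real p powr (1 / 28)
                  + U powr (3 / 13) * V powr (7 / 13)) * real p powr \<epsilon>))"
proof (intro allI impI)
  fix \<epsilon> :: real assume \<epsilon>: "\<epsilon> > 0"
  \<comment> \<open>23 is the constant of the asymptotic formula, and the square is the price of
    absorbing the squared logarithm into \<open>p powr \<epsilon>\<close>.\<close>
  define C where "C = 23 * (3 + 4 / \<epsilon>)\<^sup>2"
  show "\<exists>C::real. \<forall>(p::nat) (a::int) (g::int) (t::nat) (U::real) (V::real).
       prime p \<longrightarrow> gcd a (int p) = 1 \<longrightarrow>
       coprime (int p) g \<longrightarrow> t = ord (int p) g \<longrightarrow>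
       U > 0 \<longrightarrow> V > 0 \<longrightarrow> U \<le> real t \<longrightarrow> V \<le> real t \<longrightarrow>
       U ^ 6 * V \<ge> real p powr (15 / 4) \<longrightarrow>
       \<bar>real (num_visible_points a g p U V) - 6 / pi\<^sup>2 * (U * V / real p)\<bar>
         \<le> C * ((U powr (6 / 7) * V powr (1 / 7) / real p powr (1 / 28)
                  + U powr (3 / 13) * V powr (7 / 13)) * real p powr \<epsilon>)"
  proof (intro exI[of _ C] allI impI)
    fix p :: nat and a g :: int and t :: nat and U V :: real
    assume p: "prime p" and a: "gcd a (int p) = 1" and g: "coprime (int p) g" and t: "t = ord (int p) g"
      and U: "U > 0" and V: "V > 0" and Ut: "U \<le> real t" and Vt: "V \<le> real t"
      and UV: "U ^ 6 * V \<ge> real p powr (15 / 4)"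
    define E where "E = U powr (6 / 7) * V powr (1 / 7) / real p powr (1 / 28)"
    define F where "F = U powr (3 / 13) * V powr (7 / 13)"
    have EF: "E \<ge> 0" "F \<ge> 0" by (simp_all add: E_def F_def)
    have p1: "real p \<ge> 1" using p prime_ge_1_nat by simp
    have "\<bar>real (num_visible_points a g p U V) - 6 / pi\<^sup>2 * (U * V / real p)\<bar>
        \<le> 23 * (3 + 2 * ln (real p))\<^sup>2 * E"
      unfolding E_def using Ut Vt UV by (intro visible_points_asymptotic[OF p a g U _ V]) (auto simp: t)
    also have "\<dots> \<le> 23 * ((3 + 4 / \<epsilon>)\<^sup>2 * real p powr \<epsilon>) * (E + F)"
      using EF log_power2_le_powr[OF \<epsilon> p1] by (intro mult_mono mult_left_mono) auto
    also have "\<dots> = C * ((E + F) * real p powr \<epsilon>)" by (simp add: C_def)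
    finally show "\<bar>real (num_visible_points a g p U V) - 6 / pi\<^sup>2 * (U * V / real p)\<bar>
         \<le> C * ((U powr (6 / 7) * V powr (1 / 7) / real p powr (1 / 28)
                  + U powr (3 / 13) * V powr (7 / 13)) * real p powr \<epsilon>)"
      unfolding E_def F_def .
  qed
qed

end
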